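(* Let $\Theta\in(0,1)$, $0<p_0\le u_0<\infty$ and $0<p_1\le u_1<\infty$. Let $\frac1u:=\frac{1-\Theta}{u_0}+\frac\Theta{u_1}$ and $\frac1p:=\frac{1-\Theta}{p_0}+\frac\Theta{p_1}$. (i) If $p_0\,u_1=p_1\,u_0$, then $$\left\langle\mathcal{M}^{u_0}_{p_0}(\mathbb{R}^n),\mathcal{M}^{u_1}_{p_1}(\mathbb{R}^n),\Theta\right\rangle=\mathcal{M}^u_p(\mathbb{R}^n).$$ (ii) If $\min\{p_0,p_1\}>1$ and $p_0\,u_1\neq p_1\,u_0$, then $$\left\langle\mathcal{M}^{u_0}_{p_0}(\mathbb{R}^n),\mathcal{M}^{u_1}_{p_1}(\mathbb{R}^n),\Theta\right\rangle\neq\mathcal{M}^u_p(\mathbb{R}^n).$$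
   Context: Equalities of quasi-Banach spaces are equalities of sets with equivalent quasi-norms. For $0<p\le u\le\infty$ the Morrey space $\mathcal{M}^u_p(\mathbb{R}^n)$ consists of all $p$-locally Lebesgue-integrable functions $f$ on $\mathbb{R}^n$ with $\|f\|_{\mathcal{M}^u_p(\mathbb{R}^n)}:=\sup_B|B|^{1/u-1/p}[\int_B|f(x)|^pdx]^{1/p}<\infty$ (supremum over all balls $B$ in $\mathbb{R}^n$). $\pm$-method of Gustavsson and Peetre: let $(X_0,X_1)$ be a couple of quasi-Banach spaces continuously embedded in a common Hausdorff topological vector space, with $X_0+X_1$ carrying the usual sum quasi-norm, and $\Theta\in(0,1)$. An $a\in X_0+X_1$ belongs to $\langle X_0,X_1,\Theta\rangle$ if there is a sequence $\{a_i\}_{i\in\mathbb{Z}}\subset X_0\cap X_1$ with $a=\sum_{i\in\mathbb{Z}}a_i$ (convergence in $X_0+X_1$) such that, for any finite $F\subset\mathbb{Z}$, any bounded sequence $\{\varepsilon_i\}_{i\in\mathbb{Z}}\subset\mathbb{C}$ and $j\in\{0,1\}$, $\|\sum_{i\in F}\varepsilon_i2^{i(j-\Theta)}a_i\|_{X_j}\le C\sup_{i\in\mathbb{Z}}|\varepsilon_i|$ with a constant $C\ge0$ independent of $F$ and $j$. The quasi-norm of $a$ is the infimum of all such $C$. *)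

theory Defs
  imports "HOL-Analysis.Analysis" "HOL-Library.Function_Algebras"
begin

text \<open>
  A quasi-normed space is a set of vectors of an ambient complex vector space (a type of class
  \<^class>\<open>ab_group_add\<close> with a scalar multiplication \<open>smul\<close>) together with its quasi-norm.
  The values of the quasi-norm outside the set are irrelevant.

  Spaces of measurable functions are represented by sets of functions that are closed under
  almost everywhere equality, rather than by sets of equivalence classes. Their quasi-norms
  vanish exactly on the functions that are 0 almost everywhere.
\<close>

record 'a qspace =
  elems :: "'a set"
  qnorm :: "'a \<Rightarrow> real"

definition space_eq :: "'a qspace \<Rightarrow> 'a qspace \<Rightarrow> bool"  (infix "\<cong>\<^sub>q" 50)
  where "X \<cong>\<^sub>q Y \<longleftrightarrow> elems X = elems Y \<and>
    (\<exists>c>0. \<exists>C>0. \<forall>a\<in>elems X. c * qnorm X a \<le> qnorm Y a \<and> qnorm Y a \<le> C * qnorm X a)"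

definition sum_space :: "'a::ab_group_add qspace \<Rightarrow> 'a qspace \<Rightarrow> 'a qspace"
  where "sum_space X0 X1 =
    \<lparr> elems = {a0 + a1 | a0 a1. a0 \<in> elems X0 \<and> a1 \<in> elems X1},
      qnorm = (\<lambda>a. Inf {qnorm X0 a0 + qnorm X1 a1 | a0 a1.
                          a0 \<in> elems X0 \<and> a1 \<in> elems X1 \<and> a = a0 + a1}) \<rparr>"

text \<open>
  The series over the integers is summed along the net of finite index sets. Under the bounds in
  \<open>pm_bound\<close> this agrees with convergence of the two-sided partial sums: the bound for \<open>j = 0\<close>
  makes the \<open>X0\<close> quasi-norms decay geometrically as the index tends to minus infinity, the bound
  for \<open>j = 1\<close> does the same for \<open>X1\<close> at plus infinity.
\<close>

definition has_qsum :: "'a::ab_group_add qspace \<Rightarrow> (int \<Rightarrow> 'a) \<Rightarrow> 'a \<Rightarrow> bool"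
  where "has_qsum X s a \<longleftrightarrow>
    ((\<lambda>F. qnorm X (a - (\<Sum>i\<in>F. s i))) \<longlongrightarrow> 0) (finite_subsets_at_top UNIV)"

definition pm_bound ::
  "(complex \<Rightarrow> 'a::ab_group_add \<Rightarrow> 'a) \<Rightarrow> 'a qspace \<Rightarrow> 'a qspace \<Rightarrow> real \<Rightarrow> 'a \<Rightarrow> real \<Rightarrow> bool"
  where "pm_bound smul X0 X1 \<Theta> a C \<longleftrightarrow> 0 \<le> C \<and>
    (\<exists>s :: int \<Rightarrow> 'a.
      (\<forall>i. s i \<in> elems X0 \<inter> elems X1) \<and>
      has_qsum (sum_space X0 X1) s a \<and>
      (\<forall>F \<epsilon>. finite F \<longrightarrow> bounded (range \<epsilon>) \<longrightarrow>
        (\<forall>j\<in>{0, 1::nat}.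
          qnorm (if j = 0 then X0 else X1)
            (\<Sum>i\<in>F. smul (\<epsilon> i * of_real (2 powr (of_int i * (real j - \<Theta>)))) (s i))
          \<le> C * (SUP i. cmod (\<epsilon> i)))))"

definition pm_space ::
  "(complex \<Rightarrow> 'a::ab_group_add \<Rightarrow> 'a) \<Rightarrow> 'a qspace \<Rightarrow> 'a qspace \<Rightarrow> real \<Rightarrow> 'a qspace"
  where "pm_space smul X0 X1 \<Theta> =
    \<lparr> elems = {a \<in> elems (sum_space X0 X1). \<exists>C. pm_bound smul X0 X1 \<Theta> a C},
      qnorm = (\<lambda>a. Inf {C. pm_bound smul X0 X1 \<Theta> a C}) \<rparr>"

definition fscale :: "complex \<Rightarrow> ('x \<Rightarrow> complex) \<Rightarrow> 'x \<Rightarrow> complex"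
  where "fscale c f = (\<lambda>x. c * f x)"

lemma vector_space_fscale: "vector_space fscale"
  by unfold_locales (auto simp: fscale_def fun_eq_iff algebra_simps)

definition locally_p_integrable :: "real \<Rightarrow> (real ^ 'n \<Rightarrow> complex) \<Rightarrow> bool"
  where "locally_p_integrable p f \<longleftrightarrow> f \<in> borel_measurable lebesgue \<and>
    (\<forall>K. compact K \<longrightarrow> set_integrable lebesgue K (\<lambda>x. cmod (f x) powr p))"

definition morrey_term :: "real \<Rightarrow> real \<Rightarrow> (real ^ 'n \<Rightarrow> complex) \<Rightarrow> real ^ 'n \<Rightarrow> real \<Rightarrow> real"
  where "morrey_term u p f x r =
    measure lebesgue (ball x r) powr (1 / u - 1 / p) *
    (LINT y:ball x r|lebesgue. cmod (f y) powr p) powr (1 / p)"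

text \<open>Meaningful for finite exponents \<open>0 < p \<le> u\<close>.\<close>

definition morrey :: "real \<Rightarrow> real \<Rightarrow> (real ^ 'n \<Rightarrow> complex) qspace"
  where "morrey u p =
    \<lparr> elems = {f. locally_p_integrable p f \<and>
                  bdd_above {morrey_term u p f x r | x r. 0 < r}},
      qnorm = (\<lambda>f. Sup {morrey_term u p f x r | x r. 0 < r}) \<rparr>"

end

theory Submission
  imports Defs
begin

text \<open>
  Averaging over signs in the \<open>pm\<close> condition bounds the maximal functions of the sequences
  \<open>2 powr (i * (j - \<Theta>)) * s i\<close>, and a pointwise interpolation together with Hoelder's inequality turns
  these two bounds into a bound of the integral of \<open>|a| powr p\<close> over any set \<open>E\<close>, in terms of two
  coverings of \<open>E\<close> by balls which may be chosen independently for \<open>j = 0\<close> and \<open>j = 1\<close>. A single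
  ball for both gives the embedding of the \<open>pm\<close> space into the Morrey space for all parameters.

  If the ratios \<open>p\<^sub>j / u\<^sub>j\<close> agree, cutting a function along its level sets shows the converse embedding.

  If they differ, then \<open>p / u\<close> lies strictly between them. Take \<open>E\<close> to be a grid of \<open>m ^ n\<close> small
  balls whose spacing makes the indicator functions of \<open>E\<close> uniformly bounded in the Morrey space.
  Covering \<open>E\<close> by the small balls for the smaller ratio and by one large ball for the other ratio
  bounds the measure of \<open>E\<close> by a lower power of \<open>m\<close> than \<open>m ^ n\<close>, so that the \<open>pm\<close> quasi-norms
  are unbounded.
\<close>

subsection \<open>Morrey spaces as integral inequalities on balls\<close>

text \<open>Exponents below 1 are allowed, so the spaces themselves offer neither a triangle
  inequality nor duality; everything is reduced to integrals of powers over balls. Maximal functions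
  suffice because the two weighted bounds on |s i| decay geometrically away from one balance index,
  so that the sum of all |s i| is at most a multiple of A0^(1 - \<Theta>) A1^\<Theta>, where A0 and
  A1 are the two maximal functions. The Hoelder weights w0 = (1 - \<Theta>) p / p0 and w1 = \<Theta>
  p / p1 add up to 1 by the definition of p, and p / u is the mean of the ratios p0 / u0 and p1 / u1
  with these same weights. Hence one ball used for both coverings gives exactly the volume exponent
  1 - p / u and no contradiction; a gap needs two coverings of different geometry. With lam = p / u
  and n the dimension, the spacing m^(lam / (1 - lam)) gives the grid a diameter of order m^(1 / (1
  - lam)), so the large ball costs about m^(n (1 - mu) / (1 - lam)) for the ratio mu. This is a
  lower power than m^n as soon as mu > lam, while the small balls cost m^n.\<close>

lemma sum_fun_apply: "(\<Sum>i\<in>F. g i) x = (\<Sum>i\<in>F. g i x)"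
  for g :: "'i \<Rightarrow> 'x \<Rightarrow> 'b::comm_monoid_add"
  by (induction F rule: infinite_finite_induct) auto

text \<open>The Morrey condition raised to the power p. With nonnegative integrals local
  integrability is part of the inequality, and Fatou's lemma and sums over coverings apply
  directly.\<close>

definition morrey_le :: "real \<Rightarrow> real \<Rightarrow> (real ^ 'n \<Rightarrow> complex) \<Rightarrow> real \<Rightarrow> bool"
  where "morrey_le u p f K \<longleftrightarrow> f \<in> borel_measurable lebesgue \<and>
    (\<forall>x r. 0 < r \<longrightarrow> (\<integral>\<^sup>+y\<in>ball x r. ennreal (cmod (f y) powr p) \<partial>lebesgue)
       \<le> ennreal (K powr p * measure lebesgue (ball x r) powr (1 - p / u)))"

lemma sets_lebesgue_ball [measurable]: "ball (x :: real ^ 'n) r \<in> sets lebesgue"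
  by simp

text \<open>Raising to the power p turns |B|^(1/u - 1/p) into |B|^(p/u - 1), which is then moved to
  the other side. Integrability is assumed because \<open>LINT\<close> is 0 for non-integrable
  functions, which would make the left side true for every K \<ge> 0.\<close>

lemma morrey_term_le_iff:
  fixes f :: "real ^ 'n \<Rightarrow> complex"
  assumes "0 < p" "0 < u" "0 \<le> K" "0 < r"
  assumes int: "set_integrable lebesgue (ball x r) (\<lambda>y. cmod (f y) powr p)"
  shows "morrey_term u p f x r \<le> K \<longleftrightarrow>
    (\<integral>\<^sup>+y\<in>ball x r. ennreal (cmod (f y) powr p) \<partial>lebesgue)
       \<le> ennreal (K powr p * measure lebesgue (ball x r) powr (1 - p / u))"
proof -
  define I where "I = (LINT y:ball x r|lebesgue. cmod (f y) powr p)"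
  define V where "V = measure lebesgue (ball x r)"
  have V: "0 < V" using assms by (simp add: V_def)
  have I0: "0 \<le> I" unfolding I_def set_lebesgue_integral_def by (intro integral_nonneg_AE) auto
  have "(\<integral>\<^sup>+y\<in>ball x r. ennreal (cmod (f y) powr p) \<partial>lebesgue) = ennreal I"
  proof -
    have "(\<integral>\<^sup>+y\<in>ball x r. ennreal (cmod (f y) powr p) \<partial>lebesgue)
        = (\<integral>\<^sup>+y. ennreal (indicator (ball x r) y *\<^sub>R cmod (f y) powr p) \<partial>lebesgue)"
      by (intro nn_integral_cong) (auto split: split_indicator)
    also have "\<dots> = ennreal I"
      unfolding I_def set_lebesgue_integral_def
      using int by (intro nn_integral_eq_integral) (auto simp: set_integrable_def)
    finally show ?thesis .
  qed
  hence 1: "(\<integral>\<^sup>+y\<in>ball x r. ennreal (cmod (f y) powr p) \<partial>lebesgue)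
       \<le> ennreal (K powr p * V powr (1 - p / u)) \<longleftrightarrow> I \<le> K powr p * V powr (1 - p / u)"
    by (simp add: ennreal_le_iff)
  define T where "T = morrey_term u p f x r"
  have T0: "0 \<le> T" by (simp add: T_def morrey_term_def)
  have "T powr p = (V powr (1 / u - 1 / p) * I powr (1 / p)) powr p"
    unfolding T_def morrey_term_def I_def V_def ..
  also have "\<dots> = V powr ((1 / u - 1 / p) * p) * I"
    using I0 \<open>0 < p\<close> by (simp add: powr_mult powr_powr)
  also have "(1 / u - 1 / p) * p = p / u - 1"
    using \<open>0 < p\<close> by (simp add: left_diff_distrib)
  finally have Tp: "T powr p * V powr (1 - p / u) = I"
    using V by (simp add: mult.commute mult.left_commute powr_add [symmetric])
  have "T \<le> K \<longleftrightarrow> T powr p \<le> K powr p"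
    using T0 assms powr_less_mono2 [of p K T] powr_mono2 [of p T K] by linarith
  also have "\<dots> \<longleftrightarrow> T powr p * V powr (1 - p / u) \<le> K powr p * V powr (1 - p / u)"
    using V by simp
  also have "\<dots> \<longleftrightarrow> I \<le> K powr p * V powr (1 - p / u)"
    by (simp only: Tp)
  finally show ?thesis using 1 by (simp add: T_def V_def)
qed

lemma morrey_le_iff:
  fixes f :: "real ^ 'n \<Rightarrow> complex"
  assumes "0 < p" "0 < u" "0 \<le> K"
  shows "f \<in> elems (morrey u p) \<and> qnorm (morrey u p) f \<le> K \<longleftrightarrow> morrey_le u p f K"
proof
  assume L: "f \<in> elems (morrey u p) \<and> qnorm (morrey u p) f \<le> K"
  hence meas: "f \<in> borel_measurable lebesgue"
    and loc: "\<And>A. compact A \<Longrightarrow> set_integrable lebesgue A (\<lambda>x. cmod (f x) powr p)"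
    and bdd: "bdd_above {morrey_term u p f x r | x r. 0 < r}"
    and le: "Sup {morrey_term u p f x r | x r. 0 < r} \<le> K"
    by (auto simp: morrey_def locally_p_integrable_def)
  show "morrey_le u p f K"
    unfolding morrey_le_def
  proof (intro conjI meas allI impI)
    fix x :: "real ^ 'n" and r :: real assume "0 < r"
    \<comment> \<open>Local integrability speaks of compact sets, so the open ball is reached
      through the closed one.\<close>
    have "set_integrable lebesgue (cball x r) (\<lambda>x. cmod (f x) powr p)" by (intro loc) auto
    hence "set_integrable lebesgue (ball x r) (\<lambda>x. cmod (f x) powr p)"
      by (rule set_integrable_subset) auto
    moreover have "morrey_term u p f x r \<le> K"
      using cSup_upper [OF _ bdd, of "morrey_term u p f x r"] \<open>0 < r\<close> le by force
    ultimately show "(\<integral>\<^sup>+y\<in>ball x r. ennreal (cmod (f y) powr p) \<partial>lebesgue)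
       \<le> ennreal (K powr p * measure lebesgue (ball x r) powr (1 - p / u))"
      by (rule iffD1 [OF morrey_term_le_iff [OF assms \<open>0 < r\<close>]])
  qed
next
  assume R: "morrey_le u p f K"
  hence meas [measurable]: "f \<in> borel_measurable lebesgue"
    and le: "\<And>x r. 0 < r \<Longrightarrow> (\<integral>\<^sup>+y\<in>ball x r. ennreal (cmod (f y) powr p) \<partial>lebesgue)
       \<le> ennreal (K powr p * measure lebesgue (ball x r) powr (1 - p / u))"
    by (auto simp: morrey_le_def)
  have ball: "set_integrable lebesgue (ball x r) (\<lambda>y. cmod (f y) powr p)" if "0 < r" for x r
    unfolding set_integrable_def
  proof (rule integrableI_bounded)
    have "(\<integral>\<^sup>+y. ennreal (norm (indicator (ball x r) y *\<^sub>R cmod (f y) powr p)) \<partial>lebesgue)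
        = (\<integral>\<^sup>+y\<in>ball x r. ennreal (cmod (f y) powr p) \<partial>lebesgue)"
      by (intro nn_integral_cong) (auto split: split_indicator)
    also have "\<dots> < \<infinity>" using le [OF that, of x] by (simp add: le_less_trans)
    finally show "(\<integral>\<^sup>+y. ennreal (norm (indicator (ball x r) y *\<^sub>R cmod (f y) powr p)) \<partial>lebesgue) < \<infinity>" .
  qed measurable
  have trm: "morrey_term u p f x r \<le> K" if "0 < r" for x r
    by (rule iffD2 [OF morrey_term_le_iff [OF assms that ball [OF that]] le [OF that]])
  have "locally_p_integrable p f"
    unfolding locally_p_integrable_def
  proof (intro conjI meas allI impI)
    fix A :: "(real ^ 'n) set" assume A: "compact A"
    obtain r where r: "0 < r" "A \<subseteq> ball 0 r"
      using bounded_subset_ballD [OF compact_imp_bounded [OF A], of 0] by auto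
    have "A \<in> sets lebesgue" using lmeasurable_compact [OF A] by (rule fmeasurableD)
    thus "set_integrable lebesgue A (\<lambda>x. cmod (f x) powr p)"
      using set_integrable_subset [OF ball [OF r(1)] _ r(2)] by simp
  qed
  moreover have "bdd_above {morrey_term u p f x r | x r. 0 < r}"
    using trm by (auto intro!: bdd_aboveI [of _ K])
  moreover have "Sup {morrey_term u p f x r | x r. 0 < r} \<le> K"
    using trm by (intro cSup_least) (auto intro: exI [of _ 1])
  ultimately show "f \<in> elems (morrey u p) \<and> qnorm (morrey u p) f \<le> K"
    by (simp add: morrey_def)
qed

lemma morrey_qnorm_nonneg:
  fixes f :: "real ^ 'n \<Rightarrow> complex"
  assumes "f \<in> elems (morrey u p)"
  shows "0 \<le> qnorm (morrey u p) f"
proof -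
  have "0 \<le> morrey_term u p f 0 1" by (simp add: morrey_term_def)
  also have "\<dots> \<le> Sup {morrey_term u p f x r | x r. 0 < r}"
    using assms by (intro cSup_upper CollectI exI [of _ 0] exI [of _ 1]) (auto simp: morrey_def)
  finally show ?thesis by (simp add: morrey_def)
qed

lemma morrey_le_self:
  fixes f :: "real ^ 'n \<Rightarrow> complex"
  assumes "0 < p" "0 < u" "f \<in> elems (morrey u p)" "qnorm (morrey u p) f \<le> K"
  shows "morrey_le u p f K"
  using morrey_le_iff [of p u K f] morrey_qnorm_nonneg [OF assms(3)] assms by simp

lemma morrey_leD:
  fixes f :: "real ^ 'n \<Rightarrow> complex"
  assumes "0 < p" "0 < u" "0 \<le> K" "morrey_le u p f K"
  shows "f \<in> elems (morrey u p)" "qnorm (morrey u p) f \<le> K"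
  using morrey_le_iff [of p u K f] assms by simp_all

lemma powr_add_le:
  fixes a b p :: real
  assumes "0 < p" "0 \<le> a" "0 \<le> b"
  shows "(a + b) powr p \<le> 2 powr p * (a powr p + b powr p)"
proof -
  have "(a + b) powr p \<le> (2 * max a b) powr p" using assms by (intro powr_mono2) auto
  also have "\<dots> = 2 powr p * max a b powr p" using assms by (simp add: powr_mult)
  also have "max a b powr p \<le> a powr p + b powr p" by (auto simp: max_def)
  finally show ?thesis by simp
qed

text \<open>The exponent may be below 1, so \<open>powr_add_le\<close> replaces the triangle
  inequality. The size of the constant is irrelevant: the lemma serves to show that sums stay in the
  space.\<close>

lemma morrey_le_add:
  fixes f g :: "real ^ 'n \<Rightarrow> complex"
  assumes p: "0 < p" and f: "morrey_le u p f K" and g: "morrey_le u p g L"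
  shows "\<exists>M\<ge>0. morrey_le u p (f + g) M"
proof (intro exI conjI)
  let ?M = "(2 powr p * (K powr p + L powr p)) powr (1 / p)"
  show "0 \<le> ?M" by simp
  have [measurable]: "f \<in> borel_measurable lebesgue" "g \<in> borel_measurable lebesgue"
    using f g by (auto simp: morrey_le_def)
  show "morrey_le u p (f + g) ?M"
    unfolding morrey_le_def
  proof (intro conjI allI impI)
    show "f + g \<in> borel_measurable lebesgue" by (simp add: plus_fun_def)
    fix x :: "real ^ 'n" and r :: real assume r: "0 < r"
    let ?V = "measure lebesgue (ball x r) powr (1 - p / u)"
    have "(\<integral>\<^sup>+y\<in>ball x r. ennreal (cmod ((f + g) y) powr p) \<partial>lebesgue)
      \<le> (\<integral>\<^sup>+y. ennreal (2 powr p) * (ennreal (cmod (f y) powr p) * indicator (ball x r) y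
          + ennreal (cmod (g y) powr p) * indicator (ball x r) y) \<partial>lebesgue)"
    proof (intro nn_integral_mono)
      fix y
      have "cmod (f y + g y) powr p \<le> (cmod (f y) + cmod (g y)) powr p"
        using p by (intro powr_mono2 norm_triangle_ineq) auto
      also have "\<dots> \<le> 2 powr p * (cmod (f y) powr p + cmod (g y) powr p)"
        using p by (intro powr_add_le) auto
      finally show "ennreal (cmod ((f + g) y) powr p) * indicator (ball x r) y \<le>
          ennreal (2 powr p) * (ennreal (cmod (f y) powr p) * indicator (ball x r) y
          + ennreal (cmod (g y) powr p) * indicator (ball x r) y)"
        by (auto split: split_indicator simp: ennreal_plus [symmetric] ennreal_mult [symmetric]
            simp del: ennreal_plus)
    qed
    also have "\<dots> = ennreal (2 powr p) * ((\<integral>\<^sup>+y\<in>ball x r. ennreal (cmod (f y) powr p) \<partial>lebesgue)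
          + (\<integral>\<^sup>+y\<in>ball x r. ennreal (cmod (g y) powr p) \<partial>lebesgue))"
      by (simp add: nn_integral_cmult nn_integral_add)
    also have "\<dots> \<le> ennreal (2 powr p) * (ennreal (K powr p * ?V) + ennreal (L powr p * ?V))"
      using f g r by (intro mult_left_mono add_mono) (auto simp: morrey_le_def)
    also have "\<dots> = ennreal (2 powr p * (K powr p + L powr p) * ?V)"
      by (simp add: ennreal_plus [symmetric] ennreal_mult [symmetric] algebra_simps del: ennreal_plus)
    also have "2 powr p * (K powr p + L powr p) = ?M powr p"
      using p by (simp add: powr_powr)
    finally show "(\<integral>\<^sup>+y\<in>ball x r. ennreal (cmod ((f + g) y) powr p) \<partial>lebesgue) \<le> ennreal (?M powr p * ?V)" .
  qed
qed

text \<open>A power of |f| moves between Morrey spaces of equal ratio: |g|^q is at most c^q N^(-p)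
  |f|^p, and the volume exponents 1 - p/u and 1 - q/v coincide. This is where equality of the ratios
  enters the level set decomposition.\<close>

lemma morrey_le_powr:
  fixes f g :: "real ^ 'n \<Rightarrow> complex"
  assumes f: "morrey_le u p f N" and "0 < N" "0 < p" "0 < q" "0 \<le> c" and pu: "p / u = q / v"
    and g [measurable]: "g \<in> borel_measurable lebesgue"
    and le: "\<And>y. cmod (g y) \<le> c * (cmod (f y) / N) powr (p / q)"
  shows "morrey_le v q g c"
  unfolding morrey_le_def
proof (intro conjI allI impI g)
  have [measurable]: "f \<in> borel_measurable lebesgue" using f by (auto simp: morrey_le_def)
  fix x :: "real ^ 'n" and r :: real assume r: "0 < r"
  let ?V = "measure lebesgue (ball x r) powr (1 - q / v)"
  have "(\<integral>\<^sup>+y\<in>ball x r. ennreal (cmod (g y) powr q) \<partial>lebesgue)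
    \<le> (\<integral>\<^sup>+y. ennreal (c powr q * N powr (- p)) *
          (ennreal (cmod (f y) powr p) * indicator (ball x r) y) \<partial>lebesgue)"
  proof (intro nn_integral_mono)
    fix y
    have "cmod (g y) powr q \<le> (c * (cmod (f y) / N) powr (p / q)) powr q"
      using le \<open>0 < q\<close> by (intro powr_mono2) auto
    also have "\<dots> = c powr q * (cmod (f y) / N) powr p"
      using assms by (simp add: powr_mult powr_powr)
    also have "\<dots> = c powr q * N powr (- p) * cmod (f y) powr p"
      using assms by (simp add: powr_divide powr_minus divide_simps)
    finally show "ennreal (cmod (g y) powr q) * indicator (ball x r) y \<le>
        ennreal (c powr q * N powr (- p)) * (ennreal (cmod (f y) powr p) * indicator (ball x r) y)"
      by (auto split: split_indicator simp: ennreal_mult [symmetric])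
  qed
  also have "\<dots> = ennreal (c powr q * N powr (- p)) *
      (\<integral>\<^sup>+y\<in>ball x r. ennreal (cmod (f y) powr p) \<partial>lebesgue)"
    by (simp add: nn_integral_cmult)
  also have "\<dots> \<le> ennreal (c powr q * N powr (- p)) * ennreal (N powr p * ?V)"
    using f r pu by (intro mult_left_mono) (auto simp: morrey_le_def)
  also have "\<dots> = ennreal (c powr q * ?V)"
    using \<open>0 < N\<close> by (simp add: ennreal_mult [symmetric] powr_minus divide_simps)
  finally show "(\<integral>\<^sup>+y\<in>ball x r. ennreal (cmod (g y) powr q) \<partial>lebesgue) \<le> ennreal (c powr q * ?V)" .
qed

section \<open>Closure of Morrey spaces under linear operations\<close>

lemma morrey_mem_iff:
  fixes f :: "real ^ 'n \<Rightarrow> complex"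
  assumes "0 < p" "0 < u"
  shows "f \<in> elems (morrey u p) \<longleftrightarrow> (\<exists>K\<ge>0. morrey_le u p f K)"
  using morrey_le_self [OF assms _ order_refl] morrey_qnorm_nonneg morrey_leD(1) [OF assms]
  by metis

lemma morrey_add_mem:
  fixes f g :: "real ^ 'n \<Rightarrow> complex"
  assumes "0 < p" "0 < u" "f \<in> elems (morrey u p)" "g \<in> elems (morrey u p)"
  shows "f + g \<in> elems (morrey u p)"
proof -
  obtain K L where "morrey_le u p f K" "morrey_le u p g L"
    using assms by (auto simp: morrey_mem_iff)
  from morrey_le_add [OF assms(1) this] show ?thesis using assms by (simp add: morrey_mem_iff)
qed

lemma morrey_scale_mem:
  fixes f :: "real ^ 'n \<Rightarrow> complex"
  assumes "0 < p" "0 < u" "f \<in> elems (morrey u p)"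
  shows "fscale c f \<in> elems (morrey u p)"
proof -
  \<comment> \<open>The \<open>+ 1\<close> keeps N positive even if f vanishes almost everywhere,
    since \<open>morrey_le_powr\<close> divides by N.\<close>
  define N where "N = qnorm (morrey u p) f + 1"
  have N: "0 < N" using morrey_qnorm_nonneg [OF assms(3)] by (simp add: N_def)
  have f: "morrey_le u p f N" using assms by (intro morrey_le_self) (auto simp: N_def)
  have [measurable]: "f \<in> borel_measurable lebesgue" using f by (auto simp: morrey_le_def)
  have "morrey_le u p (fscale c f) (cmod c * N)"
    by (rule morrey_le_powr [OF f N]) (use assms N in \<open>auto simp: fscale_def norm_mult\<close>)
  thus ?thesis using assms N by (intro morrey_leD) auto
qed

lemma morrey_sum_mem:
  fixes f :: "'i \<Rightarrow> real ^ 'n \<Rightarrow> complex"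
  assumes "0 < p" "0 < u" "finite F" "\<And>i. i \<in> F \<Longrightarrow> f i \<in> elems (morrey u p)"
  shows "(\<Sum>i\<in>F. f i) \<in> elems (morrey u p)"
  using assms(3,4)
proof (induction F rule: finite_induct)
  case empty
  have "morrey_le u p (0 :: real ^ 'n \<Rightarrow> complex) 0"
    using assms by (simp add: morrey_le_def zero_fun_def)
  from morrey_leD(1) [OF assms(1,2) _ this] show ?case by (simp add: zero_fun_def)
qed (auto intro: morrey_add_mem assms)

subsection \<open>Decomposition along level sets\<close>

lemma
  assumes "\<And>a. a \<in> elems X0 \<Longrightarrow> 0 \<le> qnorm X0 a" "\<And>a. a \<in> elems X1 \<Longrightarrow> 0 \<le> qnorm X1 a"
  shows sum_space_qnorm_nonneg: "a \<in> elems (sum_space X0 X1) \<Longrightarrow> 0 \<le> qnorm (sum_space X0 X1) a"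
    and sum_space_qnorm_le: "a0 \<in> elems X0 \<Longrightarrow> a1 \<in> elems X1 \<Longrightarrow>
      qnorm (sum_space X0 X1) (a0 + a1) \<le> qnorm X0 a0 + qnorm X1 a1"
proof -
  let ?S = "\<lambda>a. {qnorm X0 a0 + qnorm X1 a1 | a0 a1. a0 \<in> elems X0 \<and> a1 \<in> elems X1 \<and> a = a0 + a1}"
  have nn: "0 \<le> t" if "t \<in> ?S a" for t a using that assms by (auto intro!: add_nonneg_nonneg)
  hence bdd: "bdd_below (?S a)" for a by (intro bdd_belowI [of _ 0]) auto
  show "0 \<le> qnorm (sum_space X0 X1) a" if "a \<in> elems (sum_space X0 X1)"
  proof -
    have "?S a \<noteq> {}" using that by (auto simp: sum_space_def)
    hence "0 \<le> Inf (?S a)" using nn by (rule cInf_greatest)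
    thus ?thesis by (simp add: sum_space_def)
  qed
  show "qnorm (sum_space X0 X1) (a0 + a1) \<le> qnorm X0 a0 + qnorm X1 a1"
    if "a0 \<in> elems X0" "a1 \<in> elems X1"
  proof -
    have "qnorm X0 a0 + qnorm X1 a1 \<in> ?S (a0 + a1)" using that by blast
    hence "Inf (?S (a0 + a1)) \<le> qnorm X0 a0 + qnorm X1 a1" using bdd by (rule cInf_lower)
    thus ?thesis by (simp add: sum_space_def)
  qed
qed

lemma sum_space_decomposition:
  assumes a: "a \<in> elems (sum_space X0 X1)" and "qnorm (sum_space X0 X1) a < \<delta>"
  obtains a0 a1 where "a0 \<in> elems X0" "a1 \<in> elems X1" "a = a0 + a1" "qnorm X0 a0 + qnorm X1 a1 < \<delta>"
proof -
  let ?S = "{qnorm X0 a0 + qnorm X1 a1 | a0 a1. a0 \<in> elems X0 \<and> a1 \<in> elems X1 \<and> a = a0 + a1}"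
  have "?S \<noteq> {}" using a by (auto simp: sum_space_def)
  moreover have "Inf ?S < \<delta>" using assms by (simp add: sum_space_def)
  ultimately obtain t where "t \<in> ?S" "t < \<delta>" by (rule cInf_lessD [elim_format]) blast
  thus ?thesis using that by blast
qed

text \<open>Here k y is the index of the level set containing y. Single pieces, tails and weighted
  finite sums of the level set decomposition all have the form W (k y) * f y, so this one estimate
  serves for all of them.\<close>

lemma morrey_le_level_weight:
  fixes f :: "real ^ 'n \<Rightarrow> complex" and k :: "real ^ 'n \<Rightarrow> int" and W :: "int \<Rightarrow> complex"
  assumes f: "morrey_le u p f N" and pos: "0 < N" "0 < p" "0 < q" and pu: "p / u = q / v"
    and k: "k \<in> measurable lebesgue (count_space UNIV)"
    and level: "\<And>y. cmod (f y) * 2 powr (of_int (k y) * e) \<le> 2 * N * (cmod (f y) / N) powr (p / q)"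
    and W: "\<And>i. cmod (W i) \<le> c * 2 powr (of_int i * e)"
  shows "morrey_le v q (\<lambda>y. W (k y) * f y) (2 * N * c)"
proof (rule morrey_le_powr [OF f pos _ pu])
  \<comment> \<open>Nonnegativity of c is read off at index 0, where the power of 2 is 1.\<close>
  have "0 \<le> c * 2 powr (of_int 0 * e)" using W [of 0] norm_ge_zero order_trans by blast
  hence c: "0 \<le> c" by simp
  thus "0 \<le> 2 * N * c" using pos by simp
  have "(\<lambda>y. W (k y)) \<in> borel_measurable lebesgue"
    by (rule measurable_compose [OF k]) simp
  thus "(\<lambda>y. W (k y) * f y) \<in> borel_measurable lebesgue"
    using f by (auto simp: morrey_le_def intro: borel_measurable_times)
  fix y
  have "cmod (W (k y) * f y) \<le> c * 2 powr (of_int (k y) * e) * cmod (f y)"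
    by (simp add: norm_mult W mult_right_mono)
  also have "\<dots> = c * (cmod (f y) * 2 powr (of_int (k y) * e))" by simp
  also have "\<dots> \<le> c * (2 * N * (cmod (f y) / N) powr (p / q))" by (rule mult_left_mono [OF level c])
  finally show "cmod (W (k y) * f y) \<le> 2 * N * c * (cmod (f y) / N) powr (p / q)" by (simp add: mult_ac)
qed

lemma powr_neg_mult_nat: "(2 powr - t) ^ m * 2 powr (x * t) = 2 powr ((x - real m) * t)" for t x :: real
proof -
  have "(2 powr - t) ^ m = 2 powr (- t * real m)"
    by (simp add: powr_powr flip: powr_realpow)
  thus ?thesis by (simp add: powr_add [symmetric] algebra_simps)
qed

text \<open>Rounding \<alpha> log t down changes the exponent by at most |\<beta>| \<le> 1, which
  costs the factor 2.\<close>

lemma floor_log_level: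
  fixes t \<alpha> \<beta> :: real
  assumes "0 < t" "\<bar>\<beta>\<bar> \<le> 1"
  shows "t * 2 powr (of_int \<lfloor>\<alpha> * log 2 t\<rfloor> * \<beta>) \<le> 2 * t powr (1 + \<alpha> * \<beta>)"
proof -
  let ?k = "of_int \<lfloor>\<alpha> * log 2 t\<rfloor> :: real"
  have "\<bar>(?k - \<alpha> * log 2 t) * \<beta>\<bar> \<le> 1 * 1"
    unfolding abs_mult using assms by (intro mult_mono) linarith+
  hence "?k * \<beta> \<le> 1 + log 2 t * (\<alpha> * \<beta>)" by (simp add: algebra_simps abs_le_iff)
  hence "2 powr (?k * \<beta>) \<le> 2 powr (1 + log 2 t * (\<alpha> * \<beta>))" by simp
  also have "\<dots> = 2 * t powr (\<alpha> * \<beta>)"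
    using assms by (simp add: powr_add powr_powr [symmetric])
  finally have "t * 2 powr (?k * \<beta>) \<le> t * (2 * t powr (\<alpha> * \<beta>))" using assms by simp
  thus ?thesis using assms by (simp add: powr_add mult_ac)
qed

lemma morrey_imp_pm_bound:
  fixes f :: "real ^ 'n \<Rightarrow> complex"
  assumes \<Theta>: "0 < \<Theta>" "\<Theta> < 1"
    and pos: "0 < p0" "0 < u0" "0 < p1" "0 < u1" "0 < p" "0 < u"
    and p: "1 / p = (1 - \<Theta>) / p0 + \<Theta> / p1"
    and r0: "p / u = p0 / u0" and r1: "p / u = p1 / u1"
    and f: "morrey_le u p f N" and N: "0 < N"
  shows "f \<in> elems (sum_space (morrey u0 p0) (morrey u1 p1))"
    and "pm_bound fscale (morrey u0 p0) (morrey u1 p1) \<Theta> f (2 * N)"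
proof -
  \<comment> \<open>Chosen so that 1 + \<alpha> (j - \<Theta>) = p / p_j for both j, as verified in
    \<open>e0\<close>. If p0 = p1, then \<alpha> = 0 and all of f lies in level 0.\<close>
  define \<alpha> where "\<alpha> = p * (1 / p1 - 1 / p0)"
  define k where "k = (\<lambda>y. \<lfloor>\<alpha> * log 2 (cmod (f y) / N)\<rfloor>)"
  define s where "s = (\<lambda>i y. of_bool (k y = i) * f y)"
  have [measurable]: "f \<in> borel_measurable lebesgue" using f by (simp add: morrey_le_def)
  have k: "k \<in> measurable lebesgue (count_space UNIV)"
    unfolding k_def log_def by measurable
  have level: "cmod (f y) * 2 powr (of_int (k y) * e) \<le> 2 * N * (cmod (f y) / N) powr (p / q)"
    if "\<bar>e\<bar> \<le> 1" "p / q = 1 + \<alpha> * e" for e q y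
  \<comment> \<open>At zeros of f the level index is a default value, which is harmless since every
    piece vanishes there.\<close>
  proof (cases "f y = 0")
    case False
    have "cmod (f y) / N * 2 powr (of_int (k y) * e) \<le> 2 * (cmod (f y) / N) powr (1 + \<alpha> * e)"
      unfolding k_def by (rule floor_log_level) (use False N that in auto)
    thus ?thesis using N that by (simp add: field_simps)
  qed simp
  have "p * (1 / p) = 1" using pos by simp
  hence e1: "p * ((1 - \<Theta>) / p0 + \<Theta> / p1) = 1" using p by simp
  have e0: "p / p0 = 1 + \<alpha> * (0 - \<Theta>)" "p / p1 = 1 + \<alpha> * (1 - \<Theta>)"
    using e1 pos unfolding \<alpha>_def by (simp_all add: algebra_simps add_divide_distrib diff_divide_distrib)
  have W0: "morrey_le u0 p0 (\<lambda>y. W (k y) * f y) (2 * N * c)"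
    if "\<And>i. cmod (W i) \<le> c * 2 powr (of_int i * (0 - \<Theta>))" for W c
    by (rule morrey_le_level_weight [OF f N _ _ r0 k level that]) (use pos \<Theta> e0 in auto)
  have W1: "morrey_le u1 p1 (\<lambda>y. W (k y) * f y) (2 * N * c)"
    if "\<And>i. cmod (W i) \<le> c * 2 powr (of_int i * (1 - \<Theta>))" for W c
    by (rule morrey_le_level_weight [OF f N _ _ r1 k level that]) (use pos \<Theta> e0 in auto)
  let ?X0 = "morrey u0 p0 :: (real ^ 'n \<Rightarrow> complex) qspace"
  let ?X1 = "morrey u1 p1 :: (real ^ 'n \<Rightarrow> complex) qspace"
  have tail: "\<exists>g0 g1. g0 \<in> elems ?X0 \<and> g1 \<in> elems ?X1 \<and> f - (\<Sum>i\<in>F. s i) = g0 + g1 \<and>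
      qnorm ?X0 g0 + qnorm ?X1 g1 \<le> 2 * N * (2 powr - \<Theta>) ^ m + 2 * N * (2 powr - (1 - \<Theta>)) ^ m"
    if F: "finite F" "{- int m<..<int m} \<subseteq> F" for F m
  proof (intro exI conjI)
    \<comment> \<open>The missing indices satisfy |i| \<ge> m. Negative ones are collected in
      \<open>?X0\<close> and nonnegative ones in \<open>?X1\<close>, because there the weight 2^(i
      (j - \<Theta>)) is large and dominates the indicator even after multiplication by the small
      factor.\<close>
    let ?W0 = "\<lambda>i. of_bool (i \<notin> F \<and> i < 0)"
    let ?W1 = "\<lambda>i. of_bool (i \<notin> F \<and> 0 \<le> i)"
    have "cmod (?W0 i) \<le> (2 powr - \<Theta>) ^ m * 2 powr (of_int i * (0 - \<Theta>))" for i
    proof (cases "i \<notin> F \<and> i < 0")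
      case True
      hence "i \<notin> {- int m<..<int m}" using F by blast
      hence "i \<le> - int m" using True by auto
      hence "0 \<le> (- real_of_int i - real m) * \<Theta>" using \<Theta> by (intro mult_nonneg_nonneg) auto
      moreover have "(2 powr - \<Theta>) ^ m * 2 powr (of_int i * (0 - \<Theta>))
          = 2 powr ((- real_of_int i - real m) * \<Theta>)"
        by (subst powr_neg_mult_nat [symmetric]) simp
      ultimately show ?thesis using True by (simp add: ge_one_powr_ge_zero)
    qed auto
    from W0 [OF this] have L0: "morrey_le u0 p0 (\<lambda>y. ?W0 (k y) * f y) (2 * N * (2 powr - \<Theta>) ^ m)" .
    have "cmod (?W1 i) \<le> (2 powr - (1 - \<Theta>)) ^ m * 2 powr (of_int i * (1 - \<Theta>))" for i
    proof (cases "i \<notin> F \<and> 0 \<le> i")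
      case True
      hence "i \<notin> {- int m<..<int m}" using F by blast
      hence "int m \<le> i" using True by auto
      hence "0 \<le> (real_of_int i - real m) * (1 - \<Theta>)" using \<Theta> by (intro mult_nonneg_nonneg) auto
      moreover have "(2 powr - (1 - \<Theta>)) ^ m * 2 powr (of_int i * (1 - \<Theta>))
          = 2 powr ((real_of_int i - real m) * (1 - \<Theta>))"
        by (rule powr_neg_mult_nat)
      ultimately show ?thesis using True by (simp add: ge_one_powr_ge_zero)
    qed auto
    from W1 [OF this] have L1: "morrey_le u1 p1 (\<lambda>y. ?W1 (k y) * f y) (2 * N * (2 powr - (1 - \<Theta>)) ^ m)" .
    have "0 \<le> 2 * N * (2 powr - \<Theta>) ^ m" "0 \<le> 2 * N * (2 powr - (1 - \<Theta>)) ^ m" using N by auto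
    note L0 = morrey_leD [OF pos(1,2) this(1) L0] and L1 = morrey_leD [OF pos(3,4) this(2) L1]
    show "(\<lambda>y. ?W0 (k y) * f y) \<in> elems ?X0" "(\<lambda>y. ?W1 (k y) * f y) \<in> elems ?X1"
      by (fact L0(1), fact L1(1))
    show "qnorm ?X0 (\<lambda>y. ?W0 (k y) * f y) + qnorm ?X1 (\<lambda>y. ?W1 (k y) * f y)
        \<le> 2 * N * (2 powr - \<Theta>) ^ m + 2 * N * (2 powr - (1 - \<Theta>)) ^ m"
      by (intro add_mono L0(2) L1(2))
    show "f - (\<Sum>i\<in>F. s i) = (\<lambda>y. ?W0 (k y) * f y) + (\<lambda>y. ?W1 (k y) * f y)"
    proof
      fix y
      have "(\<Sum>i\<in>F. s i y) = of_bool (k y \<in> F) * f y"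
        unfolding s_def using \<open>finite F\<close> by (simp add: of_bool_def if_distrib [of "\<lambda>x. x * _"] cong: if_cong)
      thus "(f - (\<Sum>i\<in>F. s i)) y = ((\<lambda>y. ?W0 (k y) * f y) + (\<lambda>y. ?W1 (k y) * f y)) y"
        by (auto simp: sum_fun_apply)
    qed
  qed
  have nn: "0 \<le> qnorm (sum_space ?X0 ?X1) g" if "g \<in> elems (sum_space ?X0 ?X1)" for g
    by (rule sum_space_qnorm_nonneg [OF _ _ that]) (auto intro: morrey_qnorm_nonneg)
  \<comment> \<open>With F empty and m = 0 the tail is f itself.\<close>
  from tail [of "{}" 0] obtain g0 g1 where "g0 \<in> elems ?X0" "g1 \<in> elems ?X1" "f = g0 + g1" by auto
  thus "f \<in> elems (sum_space ?X0 ?X1)" by (auto simp: sum_space_def)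
  have "has_qsum (sum_space ?X0 ?X1) s f"
    unfolding has_qsum_def
  proof (rule tendstoI)
    fix \<epsilon> :: real assume "0 < \<epsilon>"
    have "(\<lambda>m. 2 * N * (2 powr - \<Theta>) ^ m + 2 * N * (2 powr - (1 - \<Theta>)) ^ m) \<longlonglongrightarrow> 2 * N * 0 + 2 * N * 0"
      using \<Theta> by (intro tendsto_intros LIMSEQ_power_zero) (auto simp: powr_less_one)
    hence "eventually (\<lambda>m. 2 * N * (2 powr - \<Theta>) ^ m + 2 * N * (2 powr - (1 - \<Theta>)) ^ m < \<epsilon>) sequentially"
      using \<open>0 < \<epsilon>\<close> by (intro order_tendstoD) auto
    then obtain m where m: "2 * N * (2 powr - \<Theta>) ^ m + 2 * N * (2 powr - (1 - \<Theta>)) ^ m < \<epsilon>"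
      by (auto simp: eventually_sequentially)
    have "dist (qnorm (sum_space ?X0 ?X1) (f - (\<Sum>i\<in>F. s i))) 0 < \<epsilon>"
      if F: "finite F" "{- int m<..<int m} \<subseteq> F" for F
    proof -
      obtain g0 g1 where g: "g0 \<in> elems ?X0" "g1 \<in> elems ?X1" "f - (\<Sum>i\<in>F. s i) = g0 + g1"
        "qnorm ?X0 g0 + qnorm ?X1 g1 \<le> 2 * N * (2 powr - \<Theta>) ^ m + 2 * N * (2 powr - (1 - \<Theta>)) ^ m"
        using tail [OF F] by blast
      have "g0 + g1 \<in> elems (sum_space ?X0 ?X1)" using g by (auto simp: sum_space_def)
      from nn [OF this] have "0 \<le> qnorm (sum_space ?X0 ?X1) (g0 + g1)" .
      moreover have "qnorm (sum_space ?X0 ?X1) (g0 + g1) \<le> qnorm ?X0 g0 + qnorm ?X1 g1"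
        by (rule sum_space_qnorm_le [OF _ _ g(1,2)]) (auto intro: morrey_qnorm_nonneg)
      ultimately show ?thesis using g(4) m unfolding g(3) by (simp add: dist_real_def)
    qed
    thus "\<forall>\<^sub>F F in finite_subsets_at_top UNIV. dist (qnorm (sum_space ?X0 ?X1) (f - (\<Sum>i\<in>F. s i))) 0 < \<epsilon>"
      unfolding eventually_finite_subsets_at_top by (intro exI [of _ "{- int m<..<int m}"]) auto
  qed
  moreover have "s i \<in> elems ?X0 \<inter> elems ?X1" for i
  proof
    have eq: "s i = (\<lambda>y. of_bool (k y = i) * f y)" by (simp add: s_def)
    have "morrey_le u0 p0 (s i) (2 * N * 2 powr - (of_int i * (0 - \<Theta>)))" unfolding eq
      by (rule W0) (auto simp: powr_add [symmetric])
    thus "s i \<in> elems ?X0" by (rule morrey_leD [rotated -1]) (use pos N in auto)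
    have "morrey_le u1 p1 (s i) (2 * N * 2 powr - (of_int i * (1 - \<Theta>)))" unfolding eq
      by (rule W1) (auto simp: powr_add [symmetric])
    thus "s i \<in> elems ?X1" by (rule morrey_leD [rotated -1]) (use pos N in auto)
  qed
  moreover have "qnorm (if j = 0 then ?X0 else ?X1)
        (\<Sum>i\<in>F. fscale (\<epsilon> i * of_real (2 powr (of_int i * (real j - \<Theta>)))) (s i))
      \<le> 2 * N * (SUP i. cmod (\<epsilon> i))"
    if F: "finite F" and \<epsilon>: "bounded (range \<epsilon>)" and j: "j \<in> {0, 1 :: nat}" for F \<epsilon> j
  proof -
    let ?E = "SUP i. cmod (\<epsilon> i)"
    have "bdd_above (range (\<lambda>i. cmod (\<epsilon> i)))"
      using \<epsilon> by (auto simp: bounded_iff intro: bdd_aboveI)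
    hence E: "cmod (\<epsilon> i) \<le> ?E" for i by (rule cSUP_upper [rotated]) simp
    have "0 \<le> ?E" using E [of 0] norm_ge_zero order_trans by blast
    hence E0: "0 \<le> 2 * N * ?E" using N by simp
    \<comment> \<open>Each y lies in exactly one level set, so the finite sum is multiplication of f
      by a single coefficient; indices outside F contribute 0.\<close>
    define W where "W = (\<lambda>i. if i \<in> F then \<epsilon> i * of_real (2 powr (of_int i * (real j - \<Theta>))) else 0)"
    have eq: "(\<Sum>i\<in>F. fscale (\<epsilon> i * of_real (2 powr (of_int i * (real j - \<Theta>)))) (s i)) = (\<lambda>y. W (k y) * f y)"
    proof
      fix y
      show "(\<Sum>i\<in>F. fscale (\<epsilon> i * of_real (2 powr (of_int i * (real j - \<Theta>)))) (s i)) y = W (k y) * f y"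
        unfolding s_def sum_fun_apply fscale_def W_def using F
        by (simp add: of_bool_def if_distrib [of "\<lambda>x. x * _"] if_distrib [of "\<lambda>x. _ * x"] cong: if_cong)
    qed
    have W: "cmod (W i) \<le> ?E * 2 powr (of_int i * (real j - \<Theta>))" for i
      using E \<open>0 \<le> ?E\<close> by (auto simp: W_def norm_mult intro: mult_right_mono)
    from j consider "j = 0" | "j = 1" by auto
    thus ?thesis
    proof cases
      case 1
      have "morrey_le u0 p0 (\<lambda>y. W (k y) * f y) (2 * N * ?E)" using W 1 by (intro W0) auto
      thus ?thesis using morrey_leD(2) [OF pos(1,2) E0] 1 eq by auto
    next
      case 2
      have "morrey_le u1 p1 (\<lambda>y. W (k y) * f y) (2 * N * ?E)" using W 2 by (intro W1) auto
      thus ?thesis using morrey_leD(2) [OF pos(3,4) E0] 2 eq by auto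
    qed
  qed
  ultimately show "pm_bound fscale ?X0 ?X1 \<Theta> f (2 * N)"
    unfolding pm_bound_def using N by (intro conjI exI [of _ s]) auto
qed

subsection \<open>The covering estimate\<close>

text \<open>Sign patterns are paired so that the two members differ only at i. Their sums are x + b
  i and x - b i, whose difference is 2 b i, so one of them has modulus at least |b i|. This works
  for every positive exponent, and half of the patterns suffice, whence the factor 2.\<close>

lemma sum_over_signs_ge:
  fixes b :: "'i \<Rightarrow> complex"
  assumes F: "finite F" "i \<in> F" and p: "0 < p"
  shows "2 ^ card F * cmod (b i) powr p
    \<le> 2 * (\<Sum>S\<in>Pow F. cmod (\<Sum>k\<in>F. if k \<in> S then b k else - b k) powr p)"
proof -
  define G where "G = F - {i}"
  have G: "F = insert i G" "i \<notin> G" "finite G" using F by (auto simp: G_def)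
  let ?h = "\<lambda>S. cmod (\<Sum>k\<in>F. if k \<in> S then b k else - b k) powr p"
  have pair: "cmod (b i) powr p \<le> ?h T + ?h (insert i T)" if T: "T \<in> Pow G" for T
  proof -
    define x where "x = (\<Sum>k\<in>G. if k \<in> T then b k else - b k)"
    have 1: "(\<Sum>k\<in>F. if k \<in> T then b k else - b k) = x - b i"
      using G T by (auto simp: x_def)
    have "(\<Sum>k\<in>G. if k = i \<or> k \<in> T then b k else - b k) = x"
      unfolding x_def using G by (intro sum.cong) auto
    hence 2: "(\<Sum>k\<in>F. if k \<in> insert i T then b k else - b k) = x + b i"
      using G T by auto
    have "2 * b i = (x + b i) - (x - b i)" by simp
    hence "2 * cmod (b i) \<le> cmod (x + b i) + cmod (x - b i)"
      by (metis norm_mult norm_numeral norm_triangle_ineq4)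
    then consider "cmod (b i) \<le> cmod (x + b i)" | "cmod (b i) \<le> cmod (x - b i)" by linarith
    thus ?thesis unfolding 1 2
    proof cases
      case 1
      hence "cmod (b i) powr p \<le> cmod (x + b i) powr p" using p by (intro powr_mono2) auto
      thus "cmod (b i) powr p \<le> cmod (x - b i) powr p + cmod (x + b i) powr p"
        by (simp add: add_increasing)
    next
      case 2
      hence "cmod (b i) powr p \<le> cmod (x - b i) powr p" using p by (intro powr_mono2) auto
      thus "cmod (b i) powr p \<le> cmod (x - b i) powr p + cmod (x + b i) powr p"
        by (simp add: add_increasing2)
    qed
  qed
  have "2 ^ card F * cmod (b i) powr p = 2 * (\<Sum>T\<in>Pow G. cmod (b i) powr p)"
    using G by (simp add: card_Pow)
  also have "\<dots> \<le> 2 * (\<Sum>T\<in>Pow G. ?h T + ?h (insert i T))"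
    by (intro mult_left_mono sum_mono pair) auto
  also have "(\<Sum>T\<in>Pow G. ?h T + ?h (insert i T)) = (\<Sum>S\<in>Pow G. ?h S) + (\<Sum>S\<in>insert i ` Pow G. ?h S)"
    using G by (subst sum.reindex) (auto simp: sum.distrib inj_on_def)
  also have "\<dots> = (\<Sum>S\<in>Pow F. ?h S)"
    unfolding G(1) Pow_insert using G by (subst sum.union_disjoint) auto
  finally show ?thesis .
qed

lemma sum_geometric_int_le:
  fixes q :: real and k :: int
  assumes q: "0 \<le> q" "q < 1" and F: "finite F"
  shows "(\<Sum>i\<in>F. q ^ nat \<bar>i - k\<bar>) \<le> 2 / (1 - q)"
proof -
  have nat: "(\<Sum>n\<in>N. q ^ n) \<le> 1 / (1 - q)" if "finite N" for N
    using sum_le_suminf [OF summable_geometric that, of q] suminf_geometric [of q] q by auto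
  have half: "(\<Sum>i\<in>H. q ^ nat \<bar>i - k\<bar>) \<le> 1 / (1 - q)"
    if "H \<subseteq> F" "inj_on (\<lambda>i. nat \<bar>i - k\<bar>) H" for H
    using nat [of "(\<lambda>i. nat \<bar>i - k\<bar>) ` H"] sum.reindex [OF that(2), of "\<lambda>n. q ^ n"] finite_subset [OF that(1) F]
    by simp
  have "(\<Sum>i\<in>F. q ^ nat \<bar>i - k\<bar>) = (\<Sum>i\<in>{i\<in>F. i \<le> k}. q ^ nat \<bar>i - k\<bar>) + (\<Sum>i\<in>{i\<in>F. \<not> i \<le> k}. q ^ nat \<bar>i - k\<bar>)"
    using F by (subst sum.union_disjoint [symmetric]) (auto intro!: sum.cong)
  also have "\<dots> \<le> 1 / (1 - q) + 1 / (1 - q)"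
    by (intro add_mono half) (auto simp: inj_on_def)
  finally show ?thesis by simp
qed

text \<open>With q = 2^(- min \<Theta> (1 - \<Theta>)) this is 2 times 2 / (1 - q): a two-sided
  geometric series, and a factor 2 for rounding the balance index to an integer.\<close>

definition interp_const :: "real \<Rightarrow> real"
  where "interp_const \<Theta> = 4 / (1 - 2 powr (- min \<Theta> (1 - \<Theta>)))"

lemma interp_const_pos: "0 < \<Theta> \<Longrightarrow> \<Theta> < 1 \<Longrightarrow> 0 < interp_const \<Theta>"
  by (simp add: interp_const_def powr_less_one)

text \<open>Of the two bounds on b i one grows like 2^(i \<Theta>), the other decays like 2^(- i (1
  - \<Theta>)). Their minimum is largest where they cross and falls off geometrically on both sides,
  so bounds on the single terms already bound the sum.\<close>

lemma sum_le_interpolation: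
  fixes b :: "int \<Rightarrow> real"
  assumes \<Theta>: "0 < \<Theta>" "\<Theta> < 1" and F: "finite F" and nn: "0 \<le> A0" "0 \<le> A1" "\<And>i. 0 \<le> b i"
    and b0: "\<And>i. i \<in> F \<Longrightarrow> 2 powr (of_int i * (0 - \<Theta>)) * b i \<le> A0"
    and b1: "\<And>i. i \<in> F \<Longrightarrow> 2 powr (of_int i * (1 - \<Theta>)) * b i \<le> A1"
  shows "sum b F \<le> interp_const \<Theta> * (A0 powr (1 - \<Theta>) * A1 powr \<Theta>)"
proof (cases "A0 = 0 \<or> A1 = 0")
  case True
  have "b i = 0" if "i \<in> F" for i
    using b0 [OF that] b1 [OF that] True nn(3) [of i] by (auto simp: mult_le_0_iff)
  hence "sum b F = 0" by simp
  thus ?thesis using True by auto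
next
  case False
  hence A: "0 < A0" "0 < A1" using nn by auto
  define \<delta> where "\<delta> = min \<Theta> (1 - \<Theta>)"
  define q where "q = 2 powr (- \<delta>)"
  \<comment> \<open>The real index at which the bounds 2^(i \<Theta>) A0 and 2^(- i (1 - \<Theta>))
    A1 cross; their common value is D.\<close>
  define L where "L = log 2 (A1 / A0)"
  define k where "k = \<lfloor>L\<rfloor>"
  define D where "D = A0 powr (1 - \<Theta>) * A1 powr \<Theta>"
  have \<delta>: "0 < \<delta>" "\<delta> \<le> \<Theta>" "\<delta> \<le> 1 - \<Theta>" using \<Theta> by (auto simp: \<delta>_def)
  have q: "0 \<le> q" "q < 1" using \<delta> by (auto simp: q_def powr_less_one)
  have k: "of_int k \<le> L" "L < of_int k + 1" by (auto simp: k_def)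
  have L: "2 powr L = A1 / A0" using A by (simp add: L_def)
  have LD: "2 powr (L * \<theta>) = A1 powr \<theta> / A0 powr \<theta>" for \<theta>
    using A by (simp add: powr_powr [symmetric] L powr_divide)
  have D0: "A0 * 2 powr (L * \<Theta>) = D"
    using A by (simp add: D_def LD powr_diff)
  have D1: "A1 * 2 powr (L * (\<Theta> - 1)) = D"
    using A by (simp add: D_def LD powr_diff)
  have "0 \<le> D" by (simp add: D_def)
  have qn: "q ^ nat \<bar>i - k\<bar> = 2 powr (- \<delta> * \<bar>of_int (i - k)\<bar>)" for i
    unfolding q_def by (simp add: powr_powr flip: powr_realpow)
  have "b i \<le> 2 * D * q ^ nat \<bar>i - k\<bar>" if i: "i \<in> F" for i
  proof (cases "i \<le> k")
    case True
    have "0 \<le> (\<Theta> - \<delta>) * of_int (k - i)" using \<delta> True by (intro mult_nonneg_nonneg) auto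
    moreover have "of_int k * \<Theta> \<le> L * \<Theta>" using k \<Theta> by (intro mult_right_mono) auto
    ultimately have e: "of_int i * \<Theta> \<le> L * \<Theta> + - \<delta> * \<bar>of_int (i - k)\<bar>"
      using True by (simp add: algebra_simps)
    have "b i = 2 powr (of_int i * \<Theta>) * (2 powr (of_int i * (0 - \<Theta>)) * b i)"
      by (simp add: powr_add [symmetric] mult.assoc [symmetric])
    also have "\<dots> \<le> 2 powr (L * \<Theta> + - \<delta> * \<bar>of_int (i - k)\<bar>) * A0"
      using e nn by (intro mult_mono b0 i) auto
    also have "\<dots> = D * q ^ nat \<bar>i - k\<bar>" unfolding powr_add qn D0 [symmetric] by simp
    also have "\<dots> \<le> 2 * D * q ^ nat \<bar>i - k\<bar>" using \<open>0 \<le> D\<close> q by (intro mult_right_mono) auto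
    finally show ?thesis .
  next
    case False
    have "0 \<le> (1 - \<Theta> - \<delta>) * of_int (i - k)" using \<delta> False by (intro mult_nonneg_nonneg) auto
    \<comment> \<open>As k may lie up to 1 below L, measuring the decay from k costs a factor 2^(1 -
      \<Theta>) \<le> 2.\<close>
    moreover have "(L - of_int k) * (1 - \<Theta>) \<le> 1 * 1" using k \<Theta> by (intro mult_mono) auto
    ultimately have e: "- of_int i * (1 - \<Theta>) \<le> 1 + L * (\<Theta> - 1) + - \<delta> * \<bar>of_int (i - k)\<bar>"
      using False by (simp add: algebra_simps)
    have "b i = 2 powr (- of_int i * (1 - \<Theta>)) * (2 powr (of_int i * (1 - \<Theta>)) * b i)"
      by (simp add: powr_add [symmetric] mult.assoc [symmetric])
    also have "\<dots> \<le> 2 powr (1 + L * (\<Theta> - 1) + - \<delta> * \<bar>of_int (i - k)\<bar>) * A1"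
      using e nn by (intro mult_mono b1 i) auto
    also have "\<dots> = 2 * D * q ^ nat \<bar>i - k\<bar>" unfolding powr_add qn D1 [symmetric] by simp
    finally show ?thesis .
  qed
  hence "sum b F \<le> (\<Sum>i\<in>F. 2 * D * q ^ nat \<bar>i - k\<bar>)" by (rule sum_mono)
  also have "\<dots> = 2 * D * (\<Sum>i\<in>F. q ^ nat \<bar>i - k\<bar>)" by (simp add: sum_distrib_left)
  also have "\<dots> \<le> 2 * D * (2 / (1 - q))"
    using \<open>0 \<le> D\<close> by (intro mult_left_mono sum_geometric_int_le q F) auto
  also have "\<dots> = interp_const \<Theta> * D" by (simp add: interp_const_def q_def \<delta>_def)
  finally show ?thesis by (simp add: D_def)
qed

text \<open>Hoelder's inequality by the usual normalisation: the weighted arithmetic-geometric mean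
  inequality for G0 / m0 and G1 / m1, integrated over E. Positivity of m0 and m1 permits the
  division.\<close>

lemma nn_integral_interpolation:
  fixes G0 G1 :: "'a \<Rightarrow> real"
  assumes w: "0 < w0" "0 < w1" "w0 + w1 = 1" and m: "0 < m0" "0 < m1"
    and [measurable]: "G0 \<in> borel_measurable M" "G1 \<in> borel_measurable M" "E \<in> sets M"
    and nn: "\<And>y. 0 \<le> G0 y" "\<And>y. 0 \<le> G1 y"
    and int: "(\<integral>\<^sup>+y\<in>E. ennreal (G0 y) \<partial>M) \<le> ennreal m0" "(\<integral>\<^sup>+y\<in>E. ennreal (G1 y) \<partial>M) \<le> ennreal m1"
  shows "(\<integral>\<^sup>+y\<in>E. ennreal (G0 y powr w0 * G1 y powr w1) \<partial>M) \<le> ennreal (m0 powr w0 * m1 powr w1)"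
proof -
  let ?D = "m0 powr w0 * m1 powr w1"
  have pw: "G0 y powr w0 * G1 y powr w1 \<le> ?D * w0 / m0 * G0 y + ?D * w1 / m1 * G1 y" for y
  proof (cases "G0 y = 0 \<or> G1 y = 0")
    case True
    thus ?thesis using nn [of y] w m by auto
  next
    case False
    hence G: "0 < G0 y" "0 < G1 y" using nn [of y] by (auto simp: less_le)
    have "(G0 y / m0) powr w0 * (G1 y / m1) powr w1 \<le> w0 * (G0 y / m0) + w1 * (G1 y / m1)"
      using w m G by (intro Youngs_inequality_0) auto
    hence "?D * ((G0 y / m0) powr w0 * (G1 y / m1) powr w1) \<le> ?D * (w0 * (G0 y / m0) + w1 * (G1 y / m1))"
      by (intro mult_left_mono) auto
    also have "?D * ((G0 y / m0) powr w0 * (G1 y / m1) powr w1) = G0 y powr w0 * G1 y powr w1"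
      using m G by (simp add: powr_divide)
    finally show ?thesis by (simp add: algebra_simps)
  qed
  have "(\<integral>\<^sup>+y\<in>E. ennreal (G0 y powr w0 * G1 y powr w1) \<partial>M)
    \<le> (\<integral>\<^sup>+y. ennreal (?D * w0 / m0) * (ennreal (G0 y) * indicator E y)
          + ennreal (?D * w1 / m1) * (ennreal (G1 y) * indicator E y) \<partial>M)"
  proof (intro nn_integral_mono)
    fix y
    have "ennreal (G0 y powr w0 * G1 y powr w1) \<le> ennreal (?D * w0 / m0 * G0 y + ?D * w1 / m1 * G1 y)"
      by (rule ennreal_leI [OF pw])
    also have "\<dots> = ennreal (?D * w0 / m0) * ennreal (G0 y) + ennreal (?D * w1 / m1) * ennreal (G1 y)"
      using nn [of y] w m by (simp add: ennreal_plus ennreal_mult' [symmetric])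
    finally show "ennreal (G0 y powr w0 * G1 y powr w1) * indicator E y \<le>
        ennreal (?D * w0 / m0) * (ennreal (G0 y) * indicator E y)
          + ennreal (?D * w1 / m1) * (ennreal (G1 y) * indicator E y)"
      by (auto split: split_indicator)
  qed
  also have "\<dots> = ennreal (?D * w0 / m0) * (\<integral>\<^sup>+y\<in>E. ennreal (G0 y) \<partial>M)
      + ennreal (?D * w1 / m1) * (\<integral>\<^sup>+y\<in>E. ennreal (G1 y) \<partial>M)"
    by (simp add: nn_integral_add nn_integral_cmult)
  also have "\<dots> \<le> ennreal (?D * w0 / m0) * ennreal m0 + ennreal (?D * w1 / m1) * ennreal m1"
    by (intro add_mono mult_left_mono int) auto
  also have "\<dots> = ennreal (?D * w0 + ?D * w1)"
    using w m by (simp add: ennreal_mult' [symmetric] ennreal_plus [symmetric] del: ennreal_plus)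
  also have "?D * w0 + ?D * w1 = ?D" using w by (simp flip: distrib_left)
  finally show ?thesis .
qed

section \<open>Coverings by balls\<close>

definition ball_cover :: "(real ^ 'n) set \<Rightarrow> ((real ^ 'n) \<times> real) set \<Rightarrow> bool"
  where "ball_cover E P \<longleftrightarrow> finite P \<and> (\<forall>b\<in>P. 0 < snd b) \<and> E \<subseteq> (\<Union>b\<in>P. ball (fst b) (snd b))"

text \<open>The bound that a covering yields for the integral of |f|^q over the covered set when f
  has Morrey bound 1. It depends on the shape of the covering through the ratio q / v only.\<close>

definition cover_weight :: "real \<Rightarrow> real \<Rightarrow> ((real ^ 'n) \<times> real) set \<Rightarrow> real"
  where "cover_weight v q P = (\<Sum>b\<in>P. measure lebesgue (ball (fst b) (snd b)) powr (1 - q / v))"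

lemma morrey_le_cover:
  fixes f :: "real ^ 'n \<Rightarrow> complex"
  assumes f: "morrey_le v q f C" and P: "ball_cover E P"
  shows "(\<integral>\<^sup>+y\<in>E. ennreal (cmod (f y) powr q) \<partial>lebesgue) \<le> ennreal (C powr q * cover_weight v q P)"
proof -
  have [measurable]: "f \<in> borel_measurable lebesgue" using f by (simp add: morrey_le_def)
  have fin: "finite P" using P by (simp add: ball_cover_def)
  have "(\<integral>\<^sup>+y\<in>E. ennreal (cmod (f y) powr q) \<partial>lebesgue)
    \<le> (\<integral>\<^sup>+y. (\<Sum>b\<in>P. ennreal (cmod (f y) powr q) * indicator (ball (fst b) (snd b)) y) \<partial>lebesgue)"
  proof (intro nn_integral_mono)
    fix y
    show "ennreal (cmod (f y) powr q) * indicator E y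
      \<le> (\<Sum>b\<in>P. ennreal (cmod (f y) powr q) * indicator (ball (fst b) (snd b)) y)"
    proof (cases "y \<in> E")
      case True
      then obtain b where b: "b \<in> P" "y \<in> ball (fst b) (snd b)" using P by (auto simp: ball_cover_def)
      have "ennreal (cmod (f y) powr q) * indicator E y
          = ennreal (cmod (f y) powr q) * indicator (ball (fst b) (snd b)) y" using b True by simp
      also have "\<dots> \<le> (\<Sum>b\<in>P. ennreal (cmod (f y) powr q) * indicator (ball (fst b) (snd b)) y)"
        using b fin by (intro member_le_sum) auto
      finally show ?thesis .
    qed simp
  qed
  also have "\<dots> = (\<Sum>b\<in>P. \<integral>\<^sup>+y\<in>ball (fst b) (snd b). ennreal (cmod (f y) powr q) \<partial>lebesgue)"
    by (rule nn_integral_sum) measurable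
  also have "\<dots> \<le> (\<Sum>b\<in>P. ennreal (C powr q * measure lebesgue (ball (fst b) (snd b)) powr (1 - q / v)))"
    using f P by (intro sum_mono) (auto simp: morrey_le_def ball_cover_def)
  also have "\<dots> = ennreal (C powr q * cover_weight v q P)"
    by (simp add: cover_weight_def sum_distrib_left)
  finally show ?thesis .
qed

text \<open>Averaging over random signs replaces Khinchine's inequality: only the maximal function of the
  pieces is needed, and it is controlled by the average for every exponent.\<close>

lemma sign_average_majorant:
  fixes b :: "'i \<Rightarrow> real ^ 'n \<Rightarrow> complex"
  assumes F: "finite F" and q: "0 < q" and P: "ball_cover E P" and E: "E \<in> sets lebesgue"
    and b: "\<And>S. morrey_le v q (\<lambda>y. \<Sum>k\<in>F. if k \<in> S then b k y else - b k y) C"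
  obtains G where "G \<in> borel_measurable lebesgue" "\<And>y. 0 \<le> G y"
    "\<And>i y. i \<in> F \<Longrightarrow> cmod (b i y) \<le> G y powr (1 / q)"
    "(\<integral>\<^sup>+y\<in>E. ennreal (G y) \<partial>lebesgue) \<le> ennreal (2 * C powr q * cover_weight v q P)"
proof
  let ?h = "\<lambda>S y. \<Sum>k\<in>F. if k \<in> S then b k y else - b k y"
  \<comment> \<open>Twice the average over all sign patterns; the 2 is the one in
    \<open>sum_over_signs_ge\<close>. A single G dominates all pieces at once, and its integral is
    bounded independently of the number of pieces.\<close>
  define G where "G = (\<lambda>y. 2 / 2 ^ card F * (\<Sum>S\<in>Pow F. cmod (?h S y) powr q))"
  have [measurable]: "?h S \<in> borel_measurable lebesgue" for S using b by (simp add: morrey_le_def)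
  show "G \<in> borel_measurable lebesgue" unfolding G_def by measurable
  show "0 \<le> G y" for y unfolding G_def by (intro mult_nonneg_nonneg sum_nonneg) auto
  show "cmod (b i y) \<le> G y powr (1 / q)" if "i \<in> F" for i y
  proof -
    have "cmod (b i y) powr q \<le> G y"
      using sum_over_signs_ge [OF F that q, of "\<lambda>i. b i y"] by (simp add: G_def field_simps)
    hence "(cmod (b i y) powr q) powr (1 / q) \<le> G y powr (1 / q)" using q by (intro powr_mono2) auto
    thus ?thesis using q by (simp add: powr_powr)
  qed
  have "(\<integral>\<^sup>+y\<in>E. ennreal (G y) \<partial>lebesgue)
    = (\<integral>\<^sup>+y. ennreal (2 / 2 ^ card F) * (\<Sum>S\<in>Pow F. ennreal (cmod (?h S y) powr q) * indicator E y) \<partial>lebesgue)"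
  proof (intro nn_integral_cong)
    fix y
    have "ennreal (G y) = ennreal (2 / 2 ^ card F) * (\<Sum>S\<in>Pow F. ennreal (cmod (?h S y) powr q))"
      unfolding G_def by (subst ennreal_mult') (auto simp: sum_nonneg)
    thus "ennreal (G y) * indicator E y
      = ennreal (2 / 2 ^ card F) * (\<Sum>S\<in>Pow F. ennreal (cmod (?h S y) powr q) * indicator E y)"
      by (simp add: sum_distrib_right mult.assoc del: sum_ennreal)
  qed
  also have "\<dots> = ennreal (2 / 2 ^ card F) * (\<Sum>S\<in>Pow F. \<integral>\<^sup>+y\<in>E. ennreal (cmod (?h S y) powr q) \<partial>lebesgue)"
    using E by (subst nn_integral_cmult; (subst nn_integral_sum)?) auto
  also have "\<dots> \<le> ennreal (2 / 2 ^ card F) * (\<Sum>S\<in>Pow F. ennreal (C powr q * cover_weight v q P))"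
    by (intro mult_left_mono sum_mono morrey_le_cover [OF b P]) auto
  also have "(\<Sum>S\<in>Pow F. ennreal (C powr q * cover_weight v q P)) = ennreal (2 ^ card F * (C powr q * cover_weight v q P))"
    using F by (simp add: card_Pow ennreal_mult' ennreal_power [symmetric])
  also have "ennreal (2 / 2 ^ card F) * \<dots> = ennreal (2 * C powr q * cover_weight v q P)"
    by (simp add: ennreal_mult' [symmetric] mult.assoc)
  finally show "(\<integral>\<^sup>+y\<in>E. ennreal (G y) \<partial>lebesgue) \<le> ennreal (2 * C powr q * cover_weight v q P)" .
qed

lemma finite_int_le_bound:
  assumes "finite (X :: int set)"
  obtains m where "X \<subseteq> {- int m..int m}"
proof -
  have "finite ((\<lambda>i. nat \<bar>i\<bar>) ` X)" using assms by simp
  then obtain m where "\<forall>i\<in>(\<lambda>i. nat \<bar>i\<bar>) ` X. i \<le> m" unfolding finite_nat_set_iff_bounded_le by blast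
  hence "X \<subseteq> {- int m..int m}" by force
  thus ?thesis by (rule that)
qed

text \<open>Replaces the net in \<open>has_qsum\<close> by the sequence of symmetric partial sums,
  as subsequences and Fatou's lemma require.\<close>

lemma filterlim_int_intervals: "filterlim (\<lambda>n. {- int n..int n}) (finite_subsets_at_top UNIV) sequentially"
  unfolding filterlim_finite_subsets_at_top
proof (intro allI impI)
  fix X :: "int set" assume "finite X \<and> X \<subseteq> UNIV"
  then obtain m where m: "X \<subseteq> {- int m..int m}" using finite_int_le_bound by blast
  have "X \<subseteq> {- int n..int n}" if "n \<ge> m" for n
    using m that by (auto simp: subset_iff)
  thus "\<forall>\<^sub>F n in sequentially. finite {- int n..int n} \<and> X \<subseteq> {- int n..int n} \<and> {- int n..int n} \<subseteq> UNIV"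
    by (auto simp: eventually_sequentially)
qed

text \<open>The maximal functions for j = 0 and j = 1 are estimated separately and meet only in
  Hoelder's inequality on E, so each may use its own covering. The bound does not depend on F, which
  allows the passage to the limit.\<close>

lemma partial_sum_estimate:
  fixes s :: "int \<Rightarrow> real ^ 'n \<Rightarrow> complex"
  assumes \<Theta>: "0 < \<Theta>" "\<Theta> < 1"
    and pos: "0 < p0" "0 < u0" "0 < p1" "0 < u1" "0 < p"
    and p: "1 / p = (1 - \<Theta>) / p0 + \<Theta> / p1"
    and C: "0 < C" and F: "finite F"
    and s: "\<And>i. s i \<in> elems (morrey u0 p0) \<inter> elems (morrey u1 p1)"
    and bound: "\<And>\<epsilon> j. bounded (range \<epsilon>) \<Longrightarrow> j \<in> {0, 1::nat} \<Longrightarrow>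
      qnorm (if j = 0 then morrey u0 p0 else morrey u1 p1)
        (\<Sum>i\<in>F. fscale (\<epsilon> i * of_real (2 powr (of_int i * (real j - \<Theta>)))) (s i)) \<le> C * (SUP i. cmod (\<epsilon> i))"
    and E: "E \<in> sets lebesgue" and P0: "ball_cover E P0" and P1: "ball_cover E P1"
    and M: "0 < cover_weight u0 p0 P0" "0 < cover_weight u1 p1 P1"
  shows "(\<integral>\<^sup>+y\<in>E. ennreal (cmod (\<Sum>i\<in>F. s i y) powr p) \<partial>lebesgue)
    \<le> ennreal (2 * interp_const \<Theta> powr p * C powr p *
        (cover_weight u0 p0 P0 powr ((1 - \<Theta>) * p / p0) * cover_weight u1 p1 P1 powr (\<Theta> * p / p1)))"
proof -
  let ?X0 = "morrey u0 p0 :: (real ^ 'n \<Rightarrow> complex) qspace"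
  let ?X1 = "morrey u1 p1 :: (real ^ 'n \<Rightarrow> complex) qspace"
  let ?b = "\<lambda>e i y. of_real (2 powr (of_int i * (e - \<Theta>))) * s i y"
  let ?w0 = "(1 - \<Theta>) * p / p0" and ?w1 = "\<Theta> * p / p1"
  let ?K = "interp_const \<Theta>"
  let ?M0 = "cover_weight u0 p0 P0" and ?M1 = "cover_weight u1 p1 P1"
  have signs: "qnorm (if j = 0 then ?X0 else ?X1) (\<lambda>y. \<Sum>k\<in>F. if k \<in> S then ?b j k y else - ?b j k y) \<le> C
      \<and> (\<lambda>y. \<Sum>k\<in>F. if k \<in> S then ?b j k y else - ?b j k y) \<in> elems (if j = 0 then ?X0 else ?X1)"
    if j: "j \<in> {0, 1 :: nat}" for j S
  proof -
    \<comment> \<open>Signs have supremum 1, so the assumed bound is C itself for every choice of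
      S.\<close>
    define \<epsilon> :: "int \<Rightarrow> complex" where "\<epsilon> = (\<lambda>i. if i \<in> S then 1 else -1)"
    have eq: "(\<Sum>i\<in>F. fscale (\<epsilon> i * of_real (2 powr (of_int i * (real j - \<Theta>)))) (s i))
        = (\<lambda>y. \<Sum>k\<in>F. if k \<in> S then ?b j k y else - ?b j k y)"
      by (auto simp: fun_eq_iff sum_fun_apply fscale_def \<epsilon>_def intro!: sum.cong)
    have "bounded (range \<epsilon>)" by (auto simp: \<epsilon>_def bounded_iff intro!: exI [of _ 1])
    moreover have "cmod (\<epsilon> i) = 1" for i by (simp add: \<epsilon>_def)
    hence "(SUP i. cmod (\<epsilon> i)) = 1" by simp
    moreover have "(\<Sum>i\<in>F. fscale (\<epsilon> i * of_real (2 powr (of_int i * (real j - \<Theta>)))) (s i))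
        \<in> elems (if j = 0 then ?X0 else ?X1)"
      using j F s pos by (auto intro!: morrey_sum_mem morrey_scale_mem)
    ultimately show ?thesis using bound [of \<epsilon> j] j unfolding eq by simp
  qed
  have S0: "morrey_le u0 p0 (\<lambda>y. \<Sum>k\<in>F. if k \<in> S then ?b 0 k y else - ?b 0 k y) C" for S
    using signs [of 0 S, unfolded of_nat_0] by (intro morrey_le_self pos) auto
  have S1: "morrey_le u1 p1 (\<lambda>y. \<Sum>k\<in>F. if k \<in> S then ?b 1 k y else - ?b 1 k y) C" for S
    using signs [of 1 S, unfolded of_nat_1] by (intro morrey_le_self pos) auto
  obtain G0 where G0: "G0 \<in> borel_measurable lebesgue" "\<And>y. 0 \<le> G0 y"
    "\<And>i y. i \<in> F \<Longrightarrow> cmod (?b 0 i y) \<le> G0 y powr (1 / p0)"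
    "(\<integral>\<^sup>+y\<in>E. ennreal (G0 y) \<partial>lebesgue) \<le> ennreal (2 * C powr p0 * ?M0)"
    by (rule sign_average_majorant [OF F pos(1) P0 E S0]) blast
  obtain G1 where G1: "G1 \<in> borel_measurable lebesgue" "\<And>y. 0 \<le> G1 y"
    "\<And>i y. i \<in> F \<Longrightarrow> cmod (?b 1 i y) \<le> G1 y powr (1 / p1)"
    "(\<integral>\<^sup>+y\<in>E. ennreal (G1 y) \<partial>lebesgue) \<le> ennreal (2 * C powr p1 * ?M1)"
    by (rule sign_average_majorant [OF F pos(3) P1 E S1]) blast
  note [measurable] = G0(1) G1(1) E
  have K: "0 \<le> ?K" using interp_const_pos [OF \<Theta>] by simp
  have [measurable]: "s i \<in> borel_measurable lebesgue" for i
    using s [of i] by (auto simp: morrey_def locally_p_integrable_def)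
  have pw: "cmod (\<Sum>i\<in>F. s i y) powr p \<le> ?K powr p * (G0 y powr ?w0 * G1 y powr ?w1)" for y
  proof -
    have "cmod (\<Sum>i\<in>F. s i y) \<le> (\<Sum>i\<in>F. cmod (s i y))" by (rule norm_sum)
    also have "\<dots> \<le> ?K * ((G0 y powr (1 / p0)) powr (1 - \<Theta>) * (G1 y powr (1 / p1)) powr \<Theta>)"
      using G0(3) G1(3) by (intro sum_le_interpolation \<Theta> F) (auto simp: norm_mult)
    finally have "cmod (\<Sum>i\<in>F. s i y) powr p
        \<le> (?K * ((G0 y powr (1 / p0)) powr (1 - \<Theta>) * (G1 y powr (1 / p1)) powr \<Theta>)) powr p"
      using pos by (intro powr_mono2) auto
    also have "\<dots> = ?K powr p * (G0 y powr ?w0 * G1 y powr ?w1)"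
      using K by (simp add: powr_mult powr_powr)
    finally show ?thesis .
  qed
  have "p * (1 / p) = 1" using pos by simp
  hence w: "?w0 + ?w1 = 1" using p by (simp add: distrib_left mult.commute)
  have "(\<integral>\<^sup>+y\<in>E. ennreal (cmod (\<Sum>i\<in>F. s i y) powr p) \<partial>lebesgue)
    \<le> (\<integral>\<^sup>+y. ennreal (?K powr p) * (ennreal (G0 y powr ?w0 * G1 y powr ?w1) * indicator E y) \<partial>lebesgue)"
    using pw by (intro nn_integral_mono)
      (auto split: split_indicator simp: ennreal_mult' [symmetric] intro!: ennreal_leI)
  also have "\<dots> = ennreal (?K powr p) * (\<integral>\<^sup>+y\<in>E. ennreal (G0 y powr ?w0 * G1 y powr ?w1) \<partial>lebesgue)"
    by (intro nn_integral_cmult) measurable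
  also have "\<dots> \<le> ennreal (?K powr p) *
      ennreal ((2 * C powr p0 * ?M0) powr ?w0 * (2 * C powr p1 * ?M1) powr ?w1)"
    using G0 G1 E w \<Theta> pos C M by (intro mult_left_mono nn_integral_interpolation) auto
  \<comment> \<open>The constants collect to 2 C^p because \<open>?w0 + ?w1 = 1\<close> and
    \<open>p0 * ?w0 + p1 * ?w1 = p\<close>.\<close>
  also have "(2 * C powr p0 * ?M0) powr ?w0 * (2 * C powr p1 * ?M1) powr ?w1
      = 2 powr (?w0 + ?w1) * C powr ((1 - \<Theta>) * p + \<Theta> * p) * (?M0 powr ?w0 * ?M1 powr ?w1)"
    using M C pos by (simp add: powr_mult powr_powr powr_add)
  also have "(1 - \<Theta>) * p + \<Theta> * p = p" by (simp add: algebra_simps)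
  finally show ?thesis
    unfolding w by (simp add: ennreal_mult' [symmetric] mult_ac)
qed

text \<open>The two summands are small with respect to different exponents. Adding |x|^p0 and |y|^p1
  produces one sequence tending to 0 in L1 of the ball, so a single almost everywhere convergent
  subsequence serves both.\<close>

lemma locally_convergent_subseq:
  fixes x y :: "nat \<Rightarrow> real ^ 'n \<Rightarrow> complex"
  assumes pos: "0 < p0" "0 < p1" and R: "0 < R"
    and x: "\<And>n. morrey_le u0 p0 (x n) (\<eta> n)" and y: "\<And>n. morrey_le u1 p1 (y n) (\<eta> n)"
    and \<eta>: "\<And>n. 0 \<le> \<eta> n" "\<eta> \<longlonglongrightarrow> 0"
  obtains r :: "nat \<Rightarrow> nat" where "strict_mono r"
    "AE t in lebesgue. t \<in> ball z R \<longrightarrow> (\<lambda>n. x (r n) t + y (r n) t) \<longlonglongrightarrow> 0"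
proof -
  let ?B = "ball z R"
  have [measurable]: "x n \<in> borel_measurable lebesgue" "y n \<in> borel_measurable lebesgue" for n
    using x [of n] y [of n] by (auto simp: morrey_le_def)
  define U where "U = (\<lambda>n t. indicator ?B t * (cmod (x n t) powr p0 + cmod (y n t) powr p1) :: real)"
  define \<zeta> where "\<zeta> = (\<lambda>n. \<eta> n powr p0 * measure lebesgue ?B powr (1 - p0 / u0)
      + \<eta> n powr p1 * measure lebesgue ?B powr (1 - p1 / u1))"
  have \<zeta>0: "0 \<le> \<zeta> n" for n by (simp add: \<zeta>_def)
  have [measurable]: "U n \<in> borel_measurable lebesgue" for n unfolding U_def by measurable
  have nnU: "(\<integral>\<^sup>+t. ennreal (norm (U n t)) \<partial>lebesgue) \<le> ennreal (\<zeta> n)" for n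
  proof -
    have "(\<integral>\<^sup>+t. ennreal (norm (U n t)) \<partial>lebesgue)
      = (\<integral>\<^sup>+t. ennreal (cmod (x n t) powr p0) * indicator ?B t
          + ennreal (cmod (y n t) powr p1) * indicator ?B t \<partial>lebesgue)"
      by (intro nn_integral_cong) (simp add: U_def split: split_indicator)
    also have "\<dots> = (\<integral>\<^sup>+t\<in>?B. ennreal (cmod (x n t) powr p0) \<partial>lebesgue)
        + (\<integral>\<^sup>+t\<in>?B. ennreal (cmod (y n t) powr p1) \<partial>lebesgue)"
      by (intro nn_integral_add) measurable
    also have "\<dots> \<le> ennreal (\<eta> n powr p0 * measure lebesgue ?B powr (1 - p0 / u0))
        + ennreal (\<eta> n powr p1 * measure lebesgue ?B powr (1 - p1 / u1))"
      using x [of n] y [of n] R unfolding morrey_le_def by (intro add_mono) blast+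
    also have "\<dots> = ennreal (\<zeta> n)" unfolding \<zeta>_def by (intro ennreal_plus [symmetric]) auto
    finally show ?thesis .
  qed
  have intU: "integrable lebesgue (U n)" for n
    using le_less_trans [OF nnU [of n] ennreal_less_top] by (intro integrableI_bounded) auto
  have int_le: "(\<integral>t. norm (U n t) \<partial>lebesgue) \<le> \<zeta> n" for n
    using nnU [of n] \<zeta>0 [of n] nn_integral_eq_integral [OF integrable_norm [OF intU]] by simp
  have "(\<lambda>n. \<eta> n powr q) \<longlonglongrightarrow> 0" if "0 < q" for q
    by (rule tendsto_zero_powrI [OF \<eta>(2) tendsto_const]) (use \<eta> that in auto)
  from tendsto_add [OF tendsto_mult_left_zero [OF this [OF pos(1)]] tendsto_mult_left_zero [OF this [OF pos(2)]]]
  have \<zeta>: "\<zeta> \<longlonglongrightarrow> 0" unfolding \<zeta>_def by simp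
  have "(\<lambda>n. \<integral>t. norm (U n t) \<partial>lebesgue) \<longlonglongrightarrow> 0"
  proof (rule tendsto_sandwich [OF _ _ tendsto_const \<zeta>])
    show "\<forall>\<^sub>F n in sequentially. 0 \<le> (\<integral>t. norm (U n t) \<partial>lebesgue)" by simp
    show "\<forall>\<^sub>F n in sequentially. (\<integral>t. norm (U n t) \<partial>lebesgue) \<le> \<zeta> n"
      by (rule always_eventually) (use int_le in blast)
  qed
  from tendsto_L1_AE_subseq [OF intU this] obtain r where r: "strict_mono r"
    and AE: "AE t in lebesgue. (\<lambda>n. U (r n) t) \<longlonglongrightarrow> 0" by blast
  from AE have "AE t in lebesgue. t \<in> ?B \<longrightarrow> (\<lambda>n. x (r n) t + y (r n) t) \<longlonglongrightarrow> 0"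
  proof (eventually_elim, intro impI)
    fix t assume lim: "(\<lambda>n. U (r n) t) \<longlonglongrightarrow> 0" and t: "t \<in> ?B"
    have root: "(\<lambda>n. v n) \<longlonglongrightarrow> 0" if "\<And>n. cmod (v n) powr q \<le> U (r n) t" "0 < q" for v :: "nat \<Rightarrow> complex" and q
    proof (rule tendsto_norm_zero_cancel)
      have "(\<lambda>n. cmod (v n) powr q) \<longlonglongrightarrow> 0"
        by (rule tendsto_sandwich [OF _ _ tendsto_const lim]) (use that in auto)
      hence "(\<lambda>n. (cmod (v n) powr q) powr (1 / q)) \<longlonglongrightarrow> 0"
        by (rule tendsto_zero_powrI [OF _ tendsto_const]) (use that in auto)
      thus "(\<lambda>n. cmod (v n)) \<longlonglongrightarrow> 0" using that by (simp add: powr_powr)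
    qed
    have "(\<lambda>n. x (r n) t) \<longlonglongrightarrow> 0"
      by (rule root [OF _ pos(1)]) (use t in \<open>auto simp: U_def\<close>)
    moreover have "(\<lambda>n. y (r n) t) \<longlonglongrightarrow> 0"
      by (rule root [OF _ pos(2)]) (use t in \<open>auto simp: U_def\<close>)
    ultimately have "(\<lambda>n. x (r n) t + y (r n) t) \<longlonglongrightarrow> 0 + 0" by (rule tendsto_add)
    thus "(\<lambda>n. x (r n) t + y (r n) t) \<longlonglongrightarrow> 0" by simp
  qed
  with r show ?thesis by (rule that)
qed

text \<open>The estimate for partial sums passes to a by Fatou's lemma along an almost everywhere
  convergent subsequence. E lies in a ball because smallness in the sum space controls the
  remainders only locally.\<close>

lemma pm_bound_estimate:
  fixes a :: "real ^ 'n \<Rightarrow> complex"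
  assumes \<Theta>: "0 < \<Theta>" "\<Theta> < 1"
    and pos: "0 < p0" "0 < u0" "0 < p1" "0 < u1" "0 < p"
    and p: "1 / p = (1 - \<Theta>) / p0 + \<Theta> / p1"
    and C: "0 < C" and a: "a \<in> elems (sum_space (morrey u0 p0) (morrey u1 p1))"
    and pm: "pm_bound fscale (morrey u0 p0) (morrey u1 p1) \<Theta> a C"
    and E: "E \<in> sets lebesgue" "E \<subseteq> ball z R" "0 < R"
    and P0: "ball_cover E P0" and P1: "ball_cover E P1"
    and M: "0 < cover_weight u0 p0 P0" "0 < cover_weight u1 p1 P1"
  shows "(\<integral>\<^sup>+y\<in>E. ennreal (cmod (a y) powr p) \<partial>lebesgue)
    \<le> ennreal (2 * interp_const \<Theta> powr p * C powr p *
        (cover_weight u0 p0 P0 powr ((1 - \<Theta>) * p / p0) * cover_weight u1 p1 P1 powr (\<Theta> * p / p1)))"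
    (is "_ \<le> ennreal ?K")
proof -
  let ?X0 = "morrey u0 p0 :: (real ^ 'n \<Rightarrow> complex) qspace"
  let ?X1 = "morrey u1 p1 :: (real ^ 'n \<Rightarrow> complex) qspace"
  let ?S = "sum_space ?X0 ?X1"
  let ?F = "\<lambda>n :: nat. {- int n..int n}"
  from pm obtain s where s': "\<forall>i. s i \<in> elems ?X0 \<inter> elems ?X1" and sums: "has_qsum ?S s a"
    and bound': "\<forall>F \<epsilon>. finite F \<longrightarrow> bounded (range \<epsilon>) \<longrightarrow> (\<forall>j\<in>{0, 1::nat}.
      qnorm (if j = 0 then ?X0 else ?X1)
        (\<Sum>i\<in>F. fscale (\<epsilon> i * of_real (2 powr (of_int i * (real j - \<Theta>)))) (s i)) \<le> C * (SUP i. cmod (\<epsilon> i)))"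
    unfolding pm_bound_def by (elim conjE exE)
  note s = s' [rule_format] and bound = bound' [rule_format]
  have [measurable]: "s i \<in> borel_measurable lebesgue" for i
    using s [of i] by (auto simp: morrey_def locally_p_integrable_def)
  note [measurable] = E(1)
  have diff: "a - (\<Sum>i\<in>?F n. s i) \<in> elems ?S" for n
  proof -
    obtain a0 a1 where a': "a0 \<in> elems ?X0" "a1 \<in> elems ?X1" "a = a0 + a1"
      using a by (auto simp: sum_space_def)
    have "a0 + (\<Sum>i\<in>?F n. fscale (-1) (s i)) \<in> elems ?X0"
      using s pos a' by (intro morrey_add_mem morrey_sum_mem morrey_scale_mem) auto
    moreover have "a - (\<Sum>i\<in>?F n. s i) = (a0 + (\<Sum>i\<in>?F n. fscale (-1) (s i))) + a1"
      by (simp add: a' fun_eq_iff sum_fun_apply fscale_def sum_negf)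
    ultimately show ?thesis using a'(2) unfolding sum_space_def by auto
  qed
  \<comment> \<open>The infimum defining the sum quasi-norm need not be attained; the null sequence
    1 / (n + 1) leaves room for a decomposition of the remainder.\<close>
  define \<eta> where "\<eta> = (\<lambda>n. qnorm ?S (a - (\<Sum>i\<in>?F n. s i)) + 1 / real (Suc n))"
  have "\<exists>g. fst g \<in> elems ?X0 \<and> snd g \<in> elems ?X1 \<and> a - (\<Sum>i\<in>?F n. s i) = fst g + snd g \<and>
      qnorm ?X0 (fst g) + qnorm ?X1 (snd g) < \<eta> n" for n
  proof -
    have "qnorm ?S (a - (\<Sum>i\<in>?F n. s i)) < \<eta> n" by (simp add: \<eta>_def)
    then obtain a0 a1 where "a0 \<in> elems ?X0" "a1 \<in> elems ?X1" "a - (\<Sum>i\<in>?F n. s i) = a0 + a1"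
      "qnorm ?X0 a0 + qnorm ?X1 a1 < \<eta> n"
      by (rule sum_space_decomposition [OF diff])
    thus ?thesis by (intro exI [of _ "(a0, a1)"]) simp
  qed
  then obtain g where g: "\<And>n. fst (g n) \<in> elems ?X0 \<and> snd (g n) \<in> elems ?X1 \<and>
      a - (\<Sum>i\<in>?F n. s i) = fst (g n) + snd (g n) \<and> qnorm ?X0 (fst (g n)) + qnorm ?X1 (snd (g n)) < \<eta> n"
    using choice [of "\<lambda>n g. fst g \<in> elems ?X0 \<and> snd g \<in> elems ?X1 \<and>
      a - (\<Sum>i\<in>?F n. s i) = fst g + snd g \<and> qnorm ?X0 (fst g) + qnorm ?X1 (snd g) < \<eta> n"] by blast
  define x where "x n = fst (g n)" for n
  define y where "y n = snd (g n)" for n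
  have xy: "x n \<in> elems ?X0" "y n \<in> elems ?X1" "a - (\<Sum>i\<in>?F n. s i) = x n + y n"
    "qnorm ?X0 (x n) + qnorm ?X1 (y n) < \<eta> n" for n
    using g [of n] by (simp_all add: x_def y_def)
  have nn: "0 \<le> qnorm ?X0 (x n)" "0 \<le> qnorm ?X1 (y n)" for n
    by (rule morrey_qnorm_nonneg [OF xy(1)], rule morrey_qnorm_nonneg [OF xy(2)])
  have \<eta>0: "0 \<le> \<eta> n" for n using nn [of n] xy(4) [of n] by linarith
  have "(\<lambda>n. qnorm ?S (a - (\<Sum>i\<in>?F n. s i))) \<longlonglongrightarrow> 0"
    using filterlim_compose [OF sums [unfolded has_qsum_def] filterlim_int_intervals] .
  from tendsto_add [OF this LIMSEQ_Suc [OF lim_1_over_n]] have \<eta>: "\<eta> \<longlonglongrightarrow> 0"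
    unfolding \<eta>_def by simp
  have L: "morrey_le u0 p0 (x n) (\<eta> n)" "morrey_le u1 p1 (y n) (\<eta> n)" for n
    using nn [of n] xy(4) [of n] by (intro morrey_le_self pos xy; linarith)+
  obtain r where "strict_mono r"
    and r: "AE t in lebesgue. t \<in> ball z R \<longrightarrow> (\<lambda>n. x (r n) t + y (r n) t) \<longlonglongrightarrow> 0"
    by (rule locally_convergent_subseq [OF pos(1,3) E(3) L \<eta>0 \<eta>])
  let ?g = "\<lambda>n t. ennreal (cmod (\<Sum>i\<in>?F (r n). s i t) powr p) * indicator E t"
  have "AE t in lebesgue. ennreal (cmod (a t) powr p) * indicator E t \<le> liminf (\<lambda>n. ?g n t)"
    using r
  proof eventually_elim
    case (elim t)
    show ?case
    proof (cases "t \<in> E")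
      case True
      hence "(\<lambda>n. a t - (x (r n) t + y (r n) t)) \<longlonglongrightarrow> a t - 0"
        using elim E by (intro tendsto_diff tendsto_const) auto
      moreover have "a t - (x n t + y n t) = (\<Sum>i\<in>?F n. s i t)" for n
        using fun_cong [OF xy(3) [of n], of t] by (simp add: sum_fun_apply algebra_simps)
      ultimately have "(\<lambda>n. \<Sum>i\<in>?F (r n). s i t) \<longlonglongrightarrow> a t" by simp
      hence "(\<lambda>n. cmod (\<Sum>i\<in>?F (r n). s i t) powr p) \<longlonglongrightarrow> cmod (a t) powr p"
        using pos by (intro tendsto_powr' tendsto_norm tendsto_const) auto
      hence "(\<lambda>n. ?g n t) \<longlonglongrightarrow> ennreal (cmod (a t) powr p) * indicator E t"
        using True by (simp add: tendsto_ennrealI)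
      from lim_imp_Liminf [OF _ this] show ?thesis by simp
    qed simp
  qed
  hence "(\<integral>\<^sup>+y\<in>E. ennreal (cmod (a y) powr p) \<partial>lebesgue) \<le> (\<integral>\<^sup>+t. liminf (\<lambda>n. ?g n t) \<partial>lebesgue)"
    by (rule nn_integral_mono_AE)
  also have "\<dots> \<le> liminf (\<lambda>n. \<integral>\<^sup>+t. ?g n t \<partial>lebesgue)"
    by (intro nn_integral_liminf) measurable
  also have "\<dots> \<le> liminf (\<lambda>n :: nat. ennreal ?K)"
    using partial_sum_estimate [OF \<Theta> pos p C _ s bound E(1) P0 P1 M]
    by (intro Liminf_mono always_eventually allI) simp
  also have "\<dots> = ennreal ?K" by (simp add: Liminf_const)
  finally show ?thesis .
qed

subsection \<open>Grids of balls\<close>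

lemma measure_ball_scale:
  fixes x y :: "real ^ 'n"
  assumes "0 \<le> r" "0 \<le> c"
  shows "measure lebesgue (ball x (c * r)) = c ^ CARD('n) * measure lebesgue (ball y r)"
  using assms by (simp add: content_ball power_mult_distrib)

text \<open>Packing by volume: the balls of radius L / 2 around the points are disjoint and lie in
  the ball of radius r + L / 2.\<close>

lemma card_separated_le:
  fixes Q :: "(real ^ 'n) set"
  assumes L: "0 < L" and r: "0 < r" and Q: "finite Q" "Q \<subseteq> ball z r"
    and sep: "\<And>x y. x \<in> Q \<Longrightarrow> y \<in> Q \<Longrightarrow> x \<noteq> y \<Longrightarrow> L \<le> dist x y"
  shows "real (card Q) \<le> ((r + L / 2) / (L / 2)) ^ CARD('n)"
proof -
  let ?v = "measure lebesgue (ball (0 :: real ^ 'n) 1)"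
  have v: "0 < ?v" by simp
  have m: "measure lebesgue (ball x t) = t ^ CARD('n) * ?v" if "0 < t" for x :: "real ^ 'n" and t
    using measure_ball_scale [of 1 t x 0] that by simp
  have disj: "disjoint_family_on (\<lambda>x. ball x (L / 2)) Q"
    unfolding disjoint_family_on_def
  proof (intro ballI impI)
    fix x y assume xy: "x \<in> Q" "y \<in> Q" "x \<noteq> y"
    show "ball x (L / 2) \<inter> ball y (L / 2) = {}"
    proof (rule ccontr)
      assume "ball x (L / 2) \<inter> ball y (L / 2) \<noteq> {}"
      then obtain t where "dist x t < L / 2" "dist y t < L / 2" by auto
      hence "dist x y < L" using dist_triangle2 [of x y t] by linarith
      thus False using sep [OF xy] by linarith
    qed
  qed
  have "real (card Q) * ((L / 2) ^ CARD('n) * ?v) = (\<Sum>x\<in>Q. measure lebesgue (ball x (L / 2)))"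
    using L by (subst m) auto
  also have "\<dots> = measure lebesgue (\<Union>x\<in>Q. ball x (L / 2))"
    using Q disj emeasure_lborel_ball_finite
    by (intro measure_finite_Union [symmetric]) (auto simp: less_top [symmetric])
  also have "\<dots> \<le> measure lebesgue (ball z (r + L / 2))"
  proof (rule measure_mono_fmeasurable)
    show "(\<Union>x\<in>Q. ball x (L / 2)) \<subseteq> ball z (r + L / 2)"
    proof
      fix t assume "t \<in> (\<Union>x\<in>Q. ball x (L / 2))"
      then obtain x where "x \<in> Q" "dist x t < L / 2" by auto
      moreover from this have "dist z x < r" using Q by auto
      ultimately show "t \<in> ball z (r + L / 2)" using dist_triangle [of z t x] by simp
    qed
    show "(\<Union>x\<in>Q. ball x (L / 2)) \<in> sets lebesgue" using Q by (intro sets.finite_UN) auto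
  qed auto
  also have "\<dots> = (r + L / 2) ^ CARD('n) * ?v" using r L by (intro m) auto
  finally have "(real (card Q) * (L / 2) ^ CARD('n)) * ?v \<le> (r + L / 2) ^ CARD('n) * ?v"
    by (simp add: mult.assoc)
  hence "real (card Q) * (L / 2) ^ CARD('n) \<le> (r + L / 2) ^ CARD('n)" using v by simp
  moreover have "0 < (L / 2) ^ CARD('n)" using L by simp
  ultimately show ?thesis by (subst power_divide, subst pos_le_divide_eq)
qed

text \<open>A finite set which looks discrete up to scale \<open>L\<close>, full-dimensional from scale \<open>L\<close> up to the
  diameter, and is calibrated by \<open>L powr (1 - lam) = m powr lam\<close> so that the trivial bound on the
  number of points and the packing bound interpolate to a power of the radius.\<close>

lemma separated_balls_regular:
  fixes P :: "(real ^ 'n) set"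
  assumes lam: "0 < lam" "lam < 1" and L: "1 \<le> L" "L powr (1 - lam) = m powr lam" and m: "0 < m"
    and P: "finite P" "real (card P) \<le> m ^ CARD('n)"
    and sep: "\<And>x y. x \<in> P \<Longrightarrow> y \<in> P \<Longrightarrow> x \<noteq> y \<Longrightarrow> L \<le> dist x y"
    and r: "0 < r"
  defines "\<beta> \<equiv> measure lebesgue (ball (0 :: real ^ 'n) (1 / 4))"
  shows "measure lebesgue ((\<Union>x\<in>P. ball x (1 / 4)) \<inter> ball z r)
    \<le> (\<beta> powr lam + \<beta> * (8 ^ CARD('n) / measure lebesgue (ball (0 :: real ^ 'n) 1)) powr (1 - lam))
        * measure lebesgue (ball z r) powr (1 - lam)"
proof -
  define n where "n = CARD('n)"
  define v where "v = measure lebesgue (ball (0 :: real ^ 'n) 1)"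
  define V where "V = measure lebesgue (ball z r)"
  define D where "D = (\<Union>x\<in>P. ball x (1 / 4)) \<inter> ball z r"
  \<comment> \<open>The centres whose small balls can meet \<open>ball z r\<close>.\<close>
  define Q where "Q = {x\<in>P. dist z x < r + 1 / 4}"
  have Q: "finite Q" "Q \<subseteq> P" using P by (auto simp: Q_def)
  have \<beta>: "measure lebesgue (ball x (1 / 4)) = \<beta>" for x :: "real ^ 'n"
    using measure_ball_scale [of "1 / 4" 1 x 0] by (simp add: \<beta>_def)
  have \<beta>0: "0 < \<beta>" by (simp add: \<beta>_def)
  have v0: "0 < v" by (simp add: v_def)
  have V: "V = r ^ n * v"
    using measure_ball_scale [of 1 r z 0] r by (simp add: V_def v_def n_def)
  have V0: "0 < V" using r by (simp add: V_def)
  have Dsets: "D \<in> sets lebesgue" unfolding D_def using P by (intro sets.Int sets.finite_UN) auto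
  have DV: "measure lebesgue D \<le> V"
    unfolding V_def by (rule measure_mono_fmeasurable) (use Dsets in \<open>auto simp: D_def\<close>)
  have "D \<subseteq> (\<Union>x\<in>Q. ball x (1 / 4))"
  proof
    fix t assume "t \<in> D"
    then obtain x where x: "x \<in> P" "dist x t < 1 / 4" "dist z t < r" by (auto simp: D_def)
    hence "dist z x < r + 1 / 4" using dist_triangle2 [of z x t] by linarith
    thus "t \<in> (\<Union>x\<in>Q. ball x (1 / 4))" using x by (auto simp: Q_def)
  qed
  hence "measure lebesgue D \<le> measure lebesgue (\<Union>x\<in>Q. ball x (1 / 4))"
    using Q Dsets by (intro measure_mono_fmeasurable) auto
  also have "\<dots> \<le> (\<Sum>x\<in>Q. measure lebesgue (ball x (1 / 4)))"
    using Q by (intro measure_UNION_le) auto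
  finally have DQ: "measure lebesgue D \<le> real (card Q) * \<beta>" by (simp add: \<beta>)
  let ?c = "(8 ^ n / v) powr (1 - lam)"
  have "measure lebesgue D \<le> \<beta> powr lam * V powr (1 - lam) \<or> measure lebesgue D \<le> \<beta> * ?c * V powr (1 - lam)"
  \<comment> \<open>Since L \<ge> 1, in this case r + 1/4 \<le> L / 2, so two centres in Q would be
    closer than L and Q has at most one point.\<close>
  proof (cases "r \<le> L / 4")
    case True
    have "x = y" if "x \<in> Q" "y \<in> Q" for x y
    proof (rule ccontr)
      assume "x \<noteq> y"
      hence "L \<le> dist x y" using that Q by (intro sep) auto
      moreover have "dist z x < L / 2" "dist z y < L / 2" using that True L by (auto simp: Q_def)
      ultimately show False using dist_triangle3 [of x y z] by linarith
    qed
    hence "card Q \<le> 1" using Q by (simp add: card_le_Suc0_iff_eq)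
    hence "real (card Q) * \<beta> \<le> 1 * \<beta>" using \<beta>0 by (intro mult_right_mono) auto
    hence D\<beta>: "measure lebesgue D \<le> \<beta>" using DQ by linarith
    have "measure lebesgue D = measure lebesgue D powr lam * measure lebesgue D powr (1 - lam)"
      by (simp add: powr_add [symmetric])
    also have "\<dots> \<le> \<beta> powr lam * V powr (1 - lam)"
      using lam DV D\<beta> by (intro mult_mono powr_mono2) auto
    finally show ?thesis ..
  next
    case False
    have "real (card Q) \<le> ((r + 1 / 4 + L / 2) / (L / 2)) ^ n"
      unfolding n_def using L r Q sep
      by (intro card_separated_le [where z = z]) (auto simp: Q_def)
    \<comment> \<open>From 1/4 \<le> L/4 < r follows r + 1/4 + L/2 \<le> 4 r.\<close>
    also have "\<dots> \<le> (4 * r / (L / 2)) ^ n"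
      using False L r by (intro power_mono divide_right_mono) auto
    also have "4 * r / (L / 2) = 8 * r / L" by simp
    finally have c1: "real (card Q) \<le> (8 * r / L) ^ n" .
    have swap: "(t powr (1 - lam)) powr real n = (t ^ n) powr (1 - lam)" if "0 < t" for t
      using that by (simp add: powr_realpow [symmetric] powr_powr mult.commute)
    have c2: "real (card Q) \<le> m ^ n"
      using P(2) card_mono [OF P(1) Q(2)] by (simp add: n_def)
    \<comment> \<open>The packing bound is taken to the power 1 - lam and the total count m^n to the
      power lam; the calibration of L then cancels both L and m.\<close>
    have "real (card Q) = real (card Q) powr (1 - lam) * real (card Q) powr lam"
      by (simp add: powr_add [symmetric])
    also have "\<dots> \<le> ((8 * r / L) ^ n) powr (1 - lam) * (m ^ n) powr lam"
      using lam c1 c2 by (intro mult_mono powr_mono2) auto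
    also have "\<dots> = ((8 * r / L) powr (1 - lam) * m powr lam) powr n"
      using L r m by (simp add: powr_realpow [symmetric] powr_powr powr_mult mult.commute)
    also have "(8 * r / L) powr (1 - lam) * m powr lam = (8 * r) powr (1 - lam)"
      using L r m by (simp add: powr_divide flip: L(2))
    also have "((8 * r) powr (1 - lam)) powr n = ((8 * r) ^ n) powr (1 - lam)"
      by (rule swap) (use r in simp)
    also have "(8 * r) ^ n = 8 ^ n / v * V" using v0 by (simp add: V power_mult_distrib)
    also have "\<dots> powr (1 - lam) = ?c * V powr (1 - lam)"
      using v0 V0 by (subst powr_mult) auto
    finally have "real (card Q) * \<beta> \<le> ?c * V powr (1 - lam) * \<beta>" using \<beta>0 by simp
    thus ?thesis using DQ by (simp add: mult_ac)
  qed
  moreover have "0 \<le> \<beta> powr lam * V powr (1 - lam)" "0 \<le> \<beta> * ?c * V powr (1 - lam)" using \<beta>0 by auto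
  ultimately have "measure lebesgue D \<le> \<beta> powr lam * V powr (1 - lam) + \<beta> * ?c * V powr (1 - lam)" by linarith
  thus ?thesis unfolding D_def V_def n_def v_def by (simp add: distrib_right)
qed

text \<open>L times the integer points with coordinates below m. Distinct points differ by at least
  L in some coordinate; the crude l1 bound on the norm affects only constants depending on the
  dimension.\<close>

lemma exists_separated_grid:
  fixes L :: real and m :: nat
  assumes L: "0 < L"
  obtains P :: "(real ^ 'n) set" where "finite P" "card P = m ^ CARD('n)"
    "\<And>x y. x \<in> P \<Longrightarrow> y \<in> P \<Longrightarrow> x \<noteq> y \<Longrightarrow> L \<le> dist x y"
    "\<And>x. x \<in> P \<Longrightarrow> norm x \<le> real CARD('n) * (L * real m)"
proof
  define pt :: "('n \<Rightarrow> nat) \<Rightarrow> real ^ 'n" where "pt = (\<lambda>k. \<chi> i. L * real (k i))"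
  define K :: "('n \<Rightarrow> nat) set" where "K = (UNIV \<rightarrow>\<^sub>E {..<m})"
  have K: "finite K" "card K = m ^ CARD('n)" by (auto simp: K_def card_PiE intro: finite_PiE)
  have "inj pt" using L by (auto simp: inj_on_def pt_def vec_eq_iff fun_eq_iff)
  hence "inj_on pt K" by (rule inj_on_subset) auto
  thus "finite (pt ` K)" "card (pt ` K) = m ^ CARD('n)" using K by (auto simp: card_image)
  show "L \<le> dist x y" if xy: "x \<in> pt ` K" "y \<in> pt ` K" "x \<noteq> y" for x y
  proof -
    obtain k l where kl: "x = pt k" "y = pt l" using xy by blast
    hence "k \<noteq> l" using xy(3) by auto
    then obtain i where i: "k i \<noteq> l i" by (auto simp: fun_eq_iff)
    hence "1 \<le> \<bar>real (k i) - real (l i)\<bar>" by linarith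
    hence "L * 1 \<le> L * \<bar>real (k i) - real (l i)\<bar>" using L by (intro mult_left_mono) auto
    also have "\<dots> = \<bar>(x - y) $ i\<bar>" using L by (simp add: kl pt_def abs_mult flip: right_diff_distrib)
    also have "\<dots> \<le> norm (x - y)" by (rule component_le_norm_cart)
    finally show ?thesis by (simp add: dist_norm)
  qed
  show "norm x \<le> real CARD('n) * (L * real m)" if x: "x \<in> pt ` K" for x
  proof -
    obtain k where k: "k \<in> K" "x = pt k" using x by blast
    have "norm x \<le> (\<Sum>i\<in>UNIV. \<bar>x $ i\<bar>)" by (rule norm_le_l1_cart)
    also have "\<dots> \<le> (\<Sum>i\<in>(UNIV :: 'n set). L * real m)"
    proof (rule sum_mono)
      fix i :: 'n
      have "k i < m" using k(1) by (auto simp: K_def)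
      thus "\<bar>x $ i\<bar> \<le> L * real m" using L k by (auto simp: pt_def abs_mult intro!: mult_left_mono)
    qed
    finally show ?thesis by simp
  qed
qed

lemma powr_le_imp_exponent_le:
  fixes \<alpha> \<beta> A :: real
  assumes "\<And>m :: nat. 1 \<le> m \<Longrightarrow> real m powr \<alpha> \<le> A * real m powr \<beta>"
  shows "\<alpha> \<le> \<beta>"
proof (rule ccontr)
  assume "\<not> \<alpha> \<le> \<beta>"
  hence d: "0 < \<alpha> - \<beta>" by simp
  \<comment> \<open>Beyond x the power m^(\<alpha> - \<beta>) is at least |A| + 1, hence exceeds
    A.\<close>
  define x where "x = (\<bar>A\<bar> + 1) powr (1 / (\<alpha> - \<beta>))"
  obtain m :: nat where m: "max 1 x \<le> real m" using real_arch_simple by blast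
  have "A < \<bar>A\<bar> + 1" by simp
  also have "\<bar>A\<bar> + 1 = x powr (\<alpha> - \<beta>)" using d by (simp add: x_def powr_powr)
  also have "\<dots> \<le> real m powr (\<alpha> - \<beta>)" using d m by (intro powr_mono2) (auto simp: x_def)
  finally have "A * real m powr \<beta> < real m powr (\<alpha> - \<beta>) * real m powr \<beta>"
    using m by (intro mult_strict_right_mono) auto
  also have "\<dots> = real m powr \<alpha>" by (simp add: powr_add [symmetric])
  finally show False using assms [of m] m by simp
qed

subsection \<open>Comparison of the two spaces\<close>

lemma pm_bound_mono:
  assumes pm: "pm_bound smul X0 X1 \<Theta> a C" and "C \<le> C'"
  shows "pm_bound smul X0 X1 \<Theta> a C'"
proof -
  from pm obtain s where C: "0 \<le> C" and s: "\<forall>i. s i \<in> elems X0 \<inter> elems X1"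
    and sums: "has_qsum (sum_space X0 X1) s a"
    and bound: "\<forall>F \<epsilon>. finite F \<longrightarrow> bounded (range \<epsilon>) \<longrightarrow> (\<forall>j\<in>{0, 1::nat}.
      qnorm (if j = 0 then X0 else X1)
        (\<Sum>i\<in>F. smul (\<epsilon> i * of_real (2 powr (of_int i * (real j - \<Theta>)))) (s i)) \<le> C * (SUP i. cmod (\<epsilon> i)))"
    unfolding pm_bound_def by (elim conjE exE)
  have "C * (SUP i. cmod (\<epsilon> i)) \<le> C' * (SUP i. cmod (\<epsilon> i))" if "bounded (range \<epsilon>)" for \<epsilon> :: "int \<Rightarrow> complex"
  proof (rule mult_right_mono [OF \<open>C \<le> C'\<close>])
    have "bdd_above (range (\<lambda>i. cmod (\<epsilon> i)))"
      using that by (auto simp: bounded_iff intro: bdd_aboveI)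
    hence "cmod (\<epsilon> 0) \<le> (SUP i. cmod (\<epsilon> i))" by (rule cSUP_upper [rotated]) simp
    thus "0 \<le> (SUP i. cmod (\<epsilon> i))" using norm_ge_zero order_trans by blast
  qed
  note le = order_trans [OF bound [rule_format] this]
  show ?thesis unfolding pm_bound_def
    by (intro conjI exI [of _ s] s sums allI impI ballI le) (use C \<open>C \<le> C'\<close> in auto)
qed

lemma pm_space_bound:
  assumes a: "a \<in> elems (pm_space smul X0 X1 \<Theta>)" and C: "qnorm (pm_space smul X0 X1 \<Theta>) a < C"
  shows "pm_bound smul X0 X1 \<Theta> a C"
proof -
  have "{C. pm_bound smul X0 X1 \<Theta> a C} \<noteq> {}" "Inf {C. pm_bound smul X0 X1 \<Theta> a C} < C"
    using a C by (auto simp: pm_space_def)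
  then obtain C' where "pm_bound smul X0 X1 \<Theta> a C'" "C' < C"
    by (metis cInf_lessD mem_Collect_eq)
  thus ?thesis by (intro pm_bound_mono [of _ _ _ _ _ C' C]) auto
qed

lemma pm_bound_imp_qnorm_le:
  assumes "pm_bound smul X0 X1 \<Theta> a C"
  shows "qnorm (pm_space smul X0 X1 \<Theta>) a \<le> C"
proof -
  have "bdd_below {C. pm_bound smul X0 X1 \<Theta> a C}"
    by (rule bdd_belowI [of _ 0]) (auto simp: pm_bound_def)
  thus ?thesis using assms by (auto simp: pm_space_def intro: cInf_lower)
qed

lemma pm_space_qnorm_nonneg:
  assumes "a \<in> elems (pm_space smul X0 X1 \<Theta>)"
  shows "0 \<le> qnorm (pm_space smul X0 X1 \<Theta>) a"
proof -
  have "{C. pm_bound smul X0 X1 \<Theta> a C} \<noteq> {}" using assms by (auto simp: pm_space_def)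
  hence "0 \<le> Inf {C. pm_bound smul X0 X1 \<Theta> a C}"
    by (rule cInf_greatest) (auto simp: pm_bound_def)
  thus ?thesis by (simp add: pm_space_def)
qed

text \<open>With the same ball in both coverings the volume exponents combine to p (1/p - 1/u) = 1 -
  p/u, whatever the ratios are.\<close>

lemma pm_bound_imp_morrey_le:
  fixes a :: "real ^ 'n \<Rightarrow> complex"
  assumes \<Theta>: "0 < \<Theta>" "\<Theta> < 1"
    and pos: "0 < p0" "0 < u0" "0 < p1" "0 < u1" "0 < p" "0 < u"
    and p: "1 / p = (1 - \<Theta>) / p0 + \<Theta> / p1" and u: "1 / u = (1 - \<Theta>) / u0 + \<Theta> / u1"
    and C: "0 < C" and a: "a \<in> elems (sum_space (morrey u0 p0) (morrey u1 p1))"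
    and pm: "pm_bound fscale (morrey u0 p0) (morrey u1 p1) \<Theta> a C"
  shows "morrey_le u p a ((2 * interp_const \<Theta> powr p) powr (1 / p) * C)"
  unfolding morrey_le_def
proof (intro conjI allI impI)
  obtain a0 a1 where "a0 \<in> elems (morrey u0 p0)" "a1 \<in> elems (morrey u1 p1)" "a = a0 + a1"
    using a unfolding sum_space_def by auto
  thus "a \<in> borel_measurable lebesgue"
    by (auto simp: morrey_def locally_p_integrable_def plus_fun_def)
  fix x :: "real ^ 'n" and r :: real assume r: "0 < r"
  let ?V = "measure lebesgue (ball x r)"
  have V: "0 < ?V" using r by simp
  have cov: "ball_cover (ball x r) {(x, r)}" using r by (simp add: ball_cover_def)
  have wt: "cover_weight v q {(x, r)} = ?V powr (1 - q / v)" for v q by (simp add: cover_weight_def)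
  have "(\<integral>\<^sup>+y\<in>ball x r. ennreal (cmod (a y) powr p) \<partial>lebesgue)
    \<le> ennreal (2 * interp_const \<Theta> powr p * C powr p *
        ((?V powr (1 - p0 / u0)) powr ((1 - \<Theta>) * p / p0) * (?V powr (1 - p1 / u1)) powr (\<Theta> * p / p1)))"
    unfolding wt [symmetric]
    by (rule pm_bound_estimate [OF \<Theta> pos(1-5) p C a pm _ order_refl r cov cov])
      (use V in \<open>simp_all add: wt\<close>)
  also have "(?V powr (1 - p0 / u0)) powr ((1 - \<Theta>) * p / p0) * (?V powr (1 - p1 / u1)) powr (\<Theta> * p / p1)
      = ?V powr (p * ((1 - \<Theta>) / p0 + \<Theta> / p1) - p * ((1 - \<Theta>) / u0 + \<Theta> / u1))"
    using pos by (simp add: powr_powr powr_add [symmetric] field_simps)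
  also have "p * ((1 - \<Theta>) / p0 + \<Theta> / p1) - p * ((1 - \<Theta>) / u0 + \<Theta> / u1) = 1 - p / u"
    using pos by (simp flip: p u)
  also have "2 * interp_const \<Theta> powr p * C powr p = ((2 * interp_const \<Theta> powr p) powr (1 / p) * C) powr p"
    using pos C interp_const_pos [OF \<Theta>] by (simp add: powr_mult powr_powr)
  finally show "(\<integral>\<^sup>+y\<in>ball x r. ennreal (cmod (a y) powr p) \<partial>lebesgue)
    \<le> ennreal (((2 * interp_const \<Theta> powr p) powr (1 / p) * C) powr p * ?V powr (1 - p / u))" .
qed

text \<open>Both embeddings are proved with numbers C and N strictly above the quasi-norms, which
  makes them positive and avoids infima that are not attained; letting them decrease gives the norm
  inequalities. The constant 1/2 comes from the level set bound 2 N, and k from the covering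
  estimate.\<close>

lemma pm_space_morrey_eq:
  assumes \<Theta>: "0 < \<Theta>" "\<Theta> < 1"
    and pos: "0 < p0" "0 < u0" "0 < p1" "0 < u1" "0 < p" "0 < u"
    and p: "1 / p = (1 - \<Theta>) / p0 + \<Theta> / p1" and u: "1 / u = (1 - \<Theta>) / u0 + \<Theta> / u1"
    and r0: "p / u = p0 / u0" and r1: "p / u = p1 / u1"
  shows "pm_space fscale (morrey u0 p0) (morrey u1 p1) \<Theta> \<cong>\<^sub>q (morrey u p :: (real ^ 'n \<Rightarrow> complex) qspace)"
proof -
  let ?X0 = "morrey u0 p0 :: (real ^ 'n \<Rightarrow> complex) qspace"
  let ?X1 = "morrey u1 p1 :: (real ^ 'n \<Rightarrow> complex) qspace"
  let ?M = "morrey u p :: (real ^ 'n \<Rightarrow> complex) qspace"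
  let ?P = "pm_space fscale ?X0 ?X1 \<Theta>"
  define k where "k = (2 * interp_const \<Theta> powr p) powr (1 / p)"
  have k: "0 < k" using interp_const_pos [OF \<Theta>] by (simp add: k_def)
  have PM: "a \<in> elems ?M \<and> qnorm ?M a \<le> k * C"
    if a: "a \<in> elems ?P" and C: "qnorm ?P a < C" for a C
  proof -
    have C0: "0 < C" using pm_space_qnorm_nonneg [OF a] C by linarith
    have "a \<in> elems (sum_space ?X0 ?X1)" using a by (simp add: pm_space_def)
    from pm_bound_imp_morrey_le [OF \<Theta> pos p u C0 this pm_space_bound [OF a C]]
    have aM: "morrey_le u p a (k * C)" by (simp add: k_def)
    have "0 \<le> k * C" using k C0 by simp
    from morrey_leD [OF pos(5,6) this aM] show ?thesis by simp
  qed
  have MP: "a \<in> elems ?P \<and> qnorm ?P a \<le> 2 * N"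
    if a: "a \<in> elems ?M" and N: "qnorm ?M a < N" for a N
  proof -
    have N0: "0 < N" using morrey_qnorm_nonneg [OF a] N by linarith
    have "morrey_le u p a N" using a N by (intro morrey_le_self pos) auto
    from morrey_imp_pm_bound [OF \<Theta> pos p r0 r1 this N0]
    show ?thesis using pm_bound_imp_qnorm_le by (auto simp: pm_space_def)
  qed
  have elems: "elems ?P = elems ?M"
    using PM [OF _ less_add_one] MP [OF _ less_add_one] by blast
  moreover have "1 / 2 * qnorm ?P a \<le> qnorm ?M a" if "a \<in> elems ?P" for a
  proof (rule field_le_epsilon)
    fix e :: real assume "0 < e"
    thus "1 / 2 * qnorm ?P a \<le> qnorm ?M a + e"
      using MP [of a "qnorm ?M a + e"] that elems by auto
  qed
  moreover have "qnorm ?M a \<le> k * qnorm ?P a" if "a \<in> elems ?P" for a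
  proof (rule field_le_epsilon)
    fix e :: real assume "0 < e"
    thus "qnorm ?M a \<le> k * qnorm ?P a + e"
      using PM [OF that, of "qnorm ?P a + e / k"] k by (auto simp: distrib_left)
  qed
  ultimately show ?thesis
    unfolding space_eq_def using k by (intro conjI exI [of _ "1 / 2 :: real"] exI [of _ k]) auto
qed

text \<open>Counting powers of m: the radius is of order m^(1 / (1 - lam)), so the right side has
  exponent n (wa + wb (1 - mu) / (1 - lam)), which is below n because mu > lam. Here wa and wb are
  the Hoelder weights belonging to the small balls and to the large ball, and ba is the weight of
  one small ball.\<close>

lemma grid_growth_contradiction:
  fixes lam mu wa wb A ba \<beta> :: real
  assumes lam: "lam < mu" "lam < 1" and w: "wa + wb = 1" "0 < wb" and pos: "0 < \<beta>" "0 \<le> A" "0 \<le> ba"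
    and mu: "mu \<le> 1"
    and le: "\<And>m :: nat. 1 \<le> m \<Longrightarrow> real m ^ CARD('n) * \<beta> \<le> A * ((real m ^ CARD('n) * ba) powr wa *
      (measure lebesgue (ball (0 :: real ^ 'n) (real CARD('n) * (real m powr (lam / (1 - lam)) * real m) + 1))
        powr (1 - mu)) powr wb)"
  shows False
proof -
  define n where "n = CARD('n)"
  define v where "v = measure lebesgue (ball (0 :: real ^ 'n) 1)"
  define K where "K = v * (real n + 1) ^ n"
  have n: "0 < n" by (simp add: n_def)
  have v: "0 < v" by (simp add: v_def)
  hence K: "0 < K" by (simp add: K_def add_pos_pos)
  let ?e = "real n * wa + real n * (1 - mu) / (1 - lam) * wb"
  have "real m powr real n \<le> (A * (ba powr wa * (K powr (1 - mu)) powr wb) / \<beta>) * real m powr ?e"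
    if m: "1 \<le> m" for m :: nat
  proof -
    define t where "t = real m powr (1 / (1 - lam))"
    have Lm: "real m powr (lam / (1 - lam)) * real m = t"
    proof -
      have "real m powr (lam / (1 - lam)) * real m = real m powr (lam / (1 - lam) + 1)"
        using m by (simp add: powr_add)
      also have "lam / (1 - lam) + 1 = 1 / (1 - lam)" using lam by (simp add: field_simps)
      finally show ?thesis by (simp add: t_def)
    qed
    have t: "1 \<le> t" using m lam by (simp add: t_def ge_one_powr_ge_zero)
    let ?V = "measure lebesgue (ball (0 :: real ^ 'n) (real n * t + 1))"
    have "?V = (real n * t + 1) ^ n * v"
      using measure_ball_scale [of 1 "real n * t + 1" "0 :: real ^ 'n" 0] t by (simp add: v_def n_def)
    also have "\<dots> \<le> ((real n + 1) * t) ^ n * v"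
      using t v by (intro mult_right_mono power_mono) (auto simp: distrib_right)
    also have "\<dots> = K * t powr real n"
      using t by (simp add: K_def power_mult_distrib powr_realpow)
    finally have V: "?V \<le> K * t powr real n" .
    have "real m powr real n * \<beta> = real m ^ n * \<beta>" using m by (simp add: powr_realpow)
    also have "\<dots> \<le> A * ((real m ^ n * ba) powr wa * (?V powr (1 - mu)) powr wb)"
      using le [OF m] unfolding Lm n_def [symmetric] .
    also have "\<dots> \<le> A * ((real m ^ n * ba) powr wa * ((K * t powr real n) powr (1 - mu)) powr wb)"
      using V w mu pos by (intro mult_left_mono powr_mono2) auto
    also have "\<dots> = A * (ba powr wa * (K powr (1 - mu)) powr wb) * real m powr ?e"
      using m K pos by (simp add: t_def powr_mult powr_powr powr_add powr_realpow [symmetric] mult_ac)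
    finally show ?thesis using pos by (simp add: field_simps)
  qed
  from powr_le_imp_exponent_le [OF this] have "real n \<le> ?e" .
  also have "\<dots> = real n * (wa + (1 - mu) / (1 - lam) * wb)" by (simp add: algebra_simps)
  finally have "1 \<le> wa + (1 - mu) / (1 - lam) * wb" using n by simp
  hence "1 * wb \<le> (1 - mu) / (1 - lam) * wb" using w by linarith
  hence "1 \<le> (1 - mu) / (1 - lam)" using w(2) by (rule mult_right_le_imp_le)
  thus False using lam by (simp add: field_simps)
qed

text \<open>The indicator functions of the grids are bounded in the Morrey space uniformly in m, so
  the assumed equality bounds their pm quasi-norms by one C, and A is the same for all m. Both
  assignments of the two coverings to j = 0 and j = 1 are recorded, since the order of the ratios is
  not fixed here. The spacing exponent needs p / u < 1.\<close>

lemma pm_space_eq_imp_grid_bound: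
  fixes \<Theta> p0 u0 p1 u1 p u :: real
  assumes \<Theta>: "0 < \<Theta>" "\<Theta> < 1"
    and pos: "0 < p0" "0 < u0" "0 < p1" "0 < u1" "0 < p" "0 < u"
    and p: "1 / p = (1 - \<Theta>) / p0 + \<Theta> / p1"
    and pu: "p < u"
    and eq: "pm_space fscale (morrey u0 p0) (morrey u1 p1) \<Theta> \<cong>\<^sub>q (morrey u p :: (real ^ 'n \<Rightarrow> complex) qspace)"
  defines "\<beta> \<equiv> measure lebesgue (ball (0 :: real ^ 'n) (1 / 4))"
    and "\<rho> \<equiv> \<lambda>m. real CARD('n) * (real m powr (p / u / (1 - p / u)) * real m) + 1"
  shows "\<exists>A\<ge>0. \<forall>m::nat\<ge>1.
    real m ^ CARD('n) * \<beta> \<le> A * ((real m ^ CARD('n) * \<beta> powr (1 - p0 / u0)) powr ((1 - \<Theta>) * p / p0) *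
      (measure lebesgue (ball (0 :: real ^ 'n) (\<rho> m)) powr (1 - p1 / u1)) powr (\<Theta> * p / p1)) \<and>
    real m ^ CARD('n) * \<beta> \<le> A * ((measure lebesgue (ball (0 :: real ^ 'n) (\<rho> m)) powr (1 - p0 / u0)) powr ((1 - \<Theta>) * p / p0) *
      (real m ^ CARD('n) * \<beta> powr (1 - p1 / u1)) powr (\<Theta> * p / p1))"
proof -
  let ?X0 = "morrey u0 p0 :: (real ^ 'n \<Rightarrow> complex) qspace"
  let ?X1 = "morrey u1 p1 :: (real ^ 'n \<Rightarrow> complex) qspace"
  let ?M = "morrey u p :: (real ^ 'n \<Rightarrow> complex) qspace"
  let ?P = "pm_space fscale ?X0 ?X1 \<Theta>"
  define lam where "lam = p / u"
  have lam: "0 < lam" "lam < 1" using pos pu by (auto simp: lam_def)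
  obtain c where c: "0 < c" and norms: "\<And>a. a \<in> elems ?P \<Longrightarrow> c * qnorm ?P a \<le> qnorm ?M a"
    and elems: "elems ?P = elems ?M"
    using eq unfolding space_eq_def by blast
  define K0 where "K0 = \<beta> powr lam + \<beta> * (8 ^ CARD('n) / measure lebesgue (ball (0 :: real ^ 'n) 1)) powr (1 - lam)"
  define K where "K = K0 powr (1 / p)"
  \<comment> \<open>The \<open>+ 1\<close> puts C strictly above the quasi-norms, as
    \<open>pm_space_bound\<close> demands.\<close>
  define C where "C = K / c + 1"
  define A where "A = 2 * interp_const \<Theta> powr p * C powr p"
  have K: "0 \<le> K" by (simp add: K_def)
  have C: "0 < C" using K c by (simp add: C_def add_nonneg_pos)
  have \<beta>: "measure lebesgue (ball x (1 / 4)) = \<beta>" for x :: "real ^ 'n"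
    using measure_ball_scale [of "1 / 4" 1 x 0] by (simp add: \<beta>_def)
  have \<beta>0: "0 < \<beta>" by (simp add: \<beta>_def)
  have K0: "0 \<le> K0" using \<beta>0 by (simp add: K0_def)
  have main: "real m ^ CARD('n) * \<beta> \<le> A * ((real m ^ CARD('n) * \<beta> powr (1 - p0 / u0)) powr ((1 - \<Theta>) * p / p0) *
      (measure lebesgue (ball (0 :: real ^ 'n) (\<rho> m)) powr (1 - p1 / u1)) powr (\<Theta> * p / p1))" (is ?th1)
    "real m ^ CARD('n) * \<beta> \<le> A * ((measure lebesgue (ball (0 :: real ^ 'n) (\<rho> m)) powr (1 - p0 / u0)) powr ((1 - \<Theta>) * p / p0) *
      (real m ^ CARD('n) * \<beta> powr (1 - p1 / u1)) powr (\<Theta> * p / p1))" (is ?th2)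
    if m: "1 \<le> m" for m :: nat
  proof -
    \<comment> \<open>The solution of the calibration L^(1 - lam) = m^lam in
      \<open>separated_balls_regular\<close>.\<close>
    define L where "L = real m powr (lam / (1 - lam))"
    have L: "1 \<le> L" using m lam by (simp add: L_def ge_one_powr_ge_zero)
    have Lm: "L powr (1 - lam) = real m powr lam" using lam by (simp add: L_def powr_powr)
    obtain G :: "(real ^ 'n) set" where G: "finite G" "card G = m ^ CARD('n)"
      "\<And>x y. x \<in> G \<Longrightarrow> y \<in> G \<Longrightarrow> x \<noteq> y \<Longrightarrow> L \<le> dist x y"
      "\<And>x. x \<in> G \<Longrightarrow> norm x \<le> real CARD('n) * (L * real m)"
      by (rule exists_separated_grid [of L m]) (use L in auto)
    define D where "D = (\<Union>x\<in>G. ball x (1 / 4))"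
    have D [measurable]: "D \<in> sets lebesgue" unfolding D_def using G by (intro sets.finite_UN) auto
    define f :: "real ^ 'n \<Rightarrow> complex" where "f = indicator D"
    have f: "ennreal (cmod (f y) powr p) = indicator D y" for y
      by (simp add: f_def split: split_indicator)
    have "morrey_le u p f K"
      unfolding morrey_le_def
    proof (intro conjI allI impI)
      show "f \<in> borel_measurable lebesgue" unfolding f_def by measurable
      fix x :: "real ^ 'n" and r :: real assume r: "0 < r"
      have fin: "emeasure lebesgue (D \<inter> ball x r) < \<infinity>"
        using emeasure_mono [of "D \<inter> ball x r" "ball x r" lebesgue] emeasure_lborel_ball_finite [of x r]
        by (auto intro: le_less_trans)
      have "(\<integral>\<^sup>+y\<in>ball x r. ennreal (cmod (f y) powr p) \<partial>lebesgue) = (\<integral>\<^sup>+y. indicator (D \<inter> ball x r) y \<partial>lebesgue)"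
        by (simp add: f indicator_inter_arith)
      also have "\<dots> = ennreal (measure lebesgue (D \<inter> ball x r))"
        using fin by (subst nn_integral_indicator) (auto simp: emeasure_eq_ennreal_measure)
      also have "\<dots> \<le> ennreal (K0 * measure lebesgue (ball x r) powr (1 - lam))"
        unfolding D_def K0_def \<beta>_def using lam L Lm G r m
        by (intro ennreal_leI separated_balls_regular [of lam L "real m"]) auto
      also have "K0 = K powr p" using K0 pos by (simp add: K_def powr_powr)
      finally show "(\<integral>\<^sup>+y\<in>ball x r. ennreal (cmod (f y) powr p) \<partial>lebesgue)
        \<le> ennreal (K powr p * measure lebesgue (ball x r) powr (1 - p / u))" by (simp add: lam_def)
    qed
    from morrey_leD [OF pos(5,6) K this] have fM: "f \<in> elems ?M" "qnorm ?M f \<le> K" .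
    hence fP: "f \<in> elems ?P" using elems by simp
    have "c * qnorm ?P f \<le> K" using norms [OF fP] fM by linarith
    hence "qnorm ?P f \<le> K / c" using c by (simp add: pos_le_divide_eq mult.commute)
    hence "qnorm ?P f < C" by (simp add: C_def)
    from pm_space_bound [OF fP this] have pm: "pm_bound fscale ?X0 ?X1 \<Theta> f C" .
    have fS: "f \<in> elems (sum_space ?X0 ?X1)" using fP by (simp add: pm_space_def)
    have disj: "disjoint_family_on (\<lambda>x. ball x (1 / 4)) G"
      unfolding disjoint_family_on_def
    proof (intro ballI impI)
      fix x y assume xy: "x \<in> G" "y \<in> G" "x \<noteq> y"
      show "ball x (1 / 4) \<inter> ball y (1 / 4) = {}"
      proof (rule ccontr)
        assume "ball x (1 / 4) \<inter> ball y (1 / 4) \<noteq> {}"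
        then obtain t where "dist x t < 1 / 4" "dist y t < 1 / 4" by auto
        thus False using dist_triangle2 [of x y t] G(3) [OF xy] L by linarith
      qed
    qed
    have "emeasure lebesgue D = (\<Sum>x\<in>G. emeasure lebesgue (ball x (1 / 4)))"
      unfolding D_def using G disj by (intro sum_emeasure [symmetric]) auto
    also have "\<dots> = (\<Sum>x\<in>G. ennreal \<beta>)"
    proof (rule sum.cong [OF refl])
      fix x :: "real ^ 'n"
      show "emeasure lebesgue (ball x (1 / 4)) = ennreal \<beta>"
        using emeasure_eq_ennreal_measure [of lebesgue "ball x (1 / 4)"]
          emeasure_lborel_ball_finite [of x "1 / 4"] \<beta> [of x] by (simp add: less_top)
    qed
    also have "\<dots> = ennreal (real m ^ CARD('n) * \<beta>)"
      using G(2) \<beta>0 by (simp add: ennreal_mult' ennreal_of_nat_eq_real_of_nat)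
    finally have massD: "(\<integral>\<^sup>+y\<in>D. ennreal (cmod (f y) powr p) \<partial>lebesgue) = ennreal (real m ^ CARD('n) * \<beta>)"
      by (simp add: f indicator_inter_arith [symmetric])
    define small where "small = (\<lambda>x. (x, 1 / 4 :: real)) ` G"
    have \<rho>0: "0 < \<rho> m" unfolding \<rho>_def by (intro add_nonneg_pos mult_nonneg_nonneg) auto
    have D\<rho>: "D \<subseteq> ball 0 (\<rho> m)"
    proof
      fix t assume "t \<in> D"
      then obtain x where x: "x \<in> G" "dist x t < 1 / 4" by (auto simp: D_def)
      have "norm t \<le> norm x + dist x t" using norm_triangle_ineq4 [of x "x - t"] by (simp add: dist_norm)
      thus "t \<in> ball 0 (\<rho> m)" using x G(4) [of x] by (simp add: \<rho>_def L_def lam_def)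
    qed
    have covS: "ball_cover D small" using G by (auto simp: ball_cover_def small_def D_def)
    have covB: "ball_cover D {(0, \<rho> m)}" using D\<rho> \<rho>0 by (simp add: ball_cover_def)
    have wS: "cover_weight v q small = real m ^ CARD('n) * \<beta> powr (1 - q / v)" for v q
      unfolding cover_weight_def small_def
      using \<beta> by (subst sum.reindex) (auto simp: inj_on_def G(2))
    have wB: "cover_weight v q {(0 :: real ^ 'n, \<rho> m)} = measure lebesgue (ball (0 :: real ^ 'n) (\<rho> m)) powr (1 - q / v)" for v q
      by (simp add: cover_weight_def)
    have wS0: "0 < cover_weight v q small" for v q using m \<beta>0 by (simp add: wS)
    have wB0: "0 < cover_weight v q {(0 :: real ^ 'n, \<rho> m)}" for v q using \<rho>0 by (simp add: wB)
    have A0: "0 \<le> A" by (simp add: A_def)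
    note est = pm_bound_estimate [OF \<Theta> pos(1-5) p C fS pm D D\<rho> \<rho>0]
    show ?th1
      using est [OF covS covB wS0 wB0] A0 unfolding massD wS wB A_def [symmetric]
      by (subst (asm) ennreal_le_iff) auto
    show ?th2
      using est [OF covB covS wB0 wS0] A0 unfolding massD wS wB A_def [symmetric]
      by (subst (asm) ennreal_le_iff) auto
  qed
  show ?thesis
    by (intro exI [of _ A] conjI allI impI main) (simp_all add: A_def)
qed

theorem corollary2p14:
  fixes \<Theta> p0 u0 p1 u1 p u :: real
  assumes "0 < \<Theta>" and "\<Theta> < 1"
    and "0 < p0" and "p0 \<le> u0"
    and "0 < p1" and "p1 \<le> u1"
    and "1 / u = (1 - \<Theta>) / u0 + \<Theta> / u1"
    and "1 / p = (1 - \<Theta>) / p0 + \<Theta> / p1"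
  shows "(p0 * u1 = p1 * u0 \<longrightarrow>
            pm_space fscale (morrey u0 p0) (morrey u1 p1) \<Theta>
              \<cong>\<^sub>q (morrey u p :: (real ^ 'n \<Rightarrow> complex) qspace))
       \<and> (min p0 p1 > 1 \<and> p0 * u1 \<noteq> p1 * u0 \<longrightarrow>
            \<not> (pm_space fscale (morrey u0 p0) (morrey u1 p1) \<Theta>
              \<cong>\<^sub>q (morrey u p :: (real ^ 'n \<Rightarrow> complex) qspace)))"
proof -
  note \<Theta> = assms(1,2) and u = assms(7) and p = assms(8)
  have pos01: "0 < p0" "0 < u0" "0 < p1" "0 < u1" using assms by auto
  have "0 < 1 / p" "0 < 1 / u"
    unfolding p u using \<Theta> pos01 by (auto intro!: add_pos_pos divide_pos_pos)
  hence pos: "0 < p0" "0 < u0" "0 < p1" "0 < u1" "0 < p" "0 < u" using pos01 by auto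
  \<comment> \<open>The Hoelder weights of the covering estimate. They make p / u a proper weighted
    mean of the two ratios, hence equal to both if these agree and strictly between them
    otherwise.\<close>
  define w0 where "w0 = (1 - \<Theta>) * p / p0"
  define w1 where "w1 = \<Theta> * p / p1"
  have w: "0 < w0" "0 < w1" using \<Theta> pos by (auto simp: w0_def w1_def)
  have "p * (1 / p) = 1" using pos by simp
  hence w01: "w0 + w1 = 1" unfolding p by (simp add: w0_def w1_def distrib_left mult.commute)
  have "p / u = p * (1 / u)" by simp
  also have "\<dots> = w0 * (p0 / u0) + w1 * (p1 / u1)"
    unfolding u using pos by (simp add: w0_def w1_def distrib_left mult.commute)
  finally have lam: "p / u = w0 * (p0 / u0) + w1 * (p1 / u1)" .
  have w1': "w1 = 1 - w0" using w01 by simp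
  have "w0 * x + w1 * y - x = w1 * (y - x)" "w0 * x + w1 * y - y = w0 * (x - y)" for x y
    unfolding w1' by (simp_all add: algebra_simps)
  hence lam0: "p / u - p0 / u0 = w1 * (p1 / u1 - p0 / u0)"
    and lam1: "p / u - p1 / u1 = w0 * (p0 / u0 - p1 / u1)"
    unfolding lam by blast+
  have ratio: "p0 / u0 \<le> 1" "p1 / u1 \<le> 1" using assms pos by auto
  show ?thesis
  proof (intro conjI impI notI)
    assume "p0 * u1 = p1 * u0"
    hence "p0 / u0 = p1 / u1" using pos by (simp add: field_simps)
    thus "pm_space fscale (morrey u0 p0) (morrey u1 p1) \<Theta> \<cong>\<^sub>q (morrey u p :: (real ^ 'n \<Rightarrow> complex) qspace)"
      using lam0 lam1 by (intro pm_space_morrey_eq \<Theta> pos p u) auto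
  next
    assume "1 < min p0 p1 \<and> p0 * u1 \<noteq> p1 * u0"
    hence ne: "p0 / u0 \<noteq> p1 / u1" using pos by (auto simp: field_simps)
    assume eq: "pm_space fscale (morrey u0 p0) (morrey u1 p1) \<Theta> \<cong>\<^sub>q (morrey u p :: (real ^ 'n \<Rightarrow> complex) qspace)"
    let ?\<beta> = "measure lebesgue (ball (0 :: real ^ 'n) (1 / 4))"
    have \<beta>: "0 < ?\<beta>" by simp
    have order: "p0 / u0 < p / u \<and> p / u < p1 / u1 \<or> p1 / u1 < p / u \<and> p / u < p0 / u0"
    proof (cases "p0 / u0 < p1 / u1")
      case True
      hence "0 < w1 * (p1 / u1 - p0 / u0)" "0 < w0 * (p1 / u1 - p0 / u0)" using w by auto
      thus ?thesis using lam0 lam1 by (simp add: algebra_simps)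
    next
      case False
      hence "0 < w1 * (p0 / u0 - p1 / u1)" "0 < w0 * (p0 / u0 - p1 / u1)" using w ne by auto
      thus ?thesis using lam0 lam1 by (simp add: algebra_simps)
    qed
    \<comment> \<open>The larger ratio is at most 1 and p / u lies strictly below it.\<close>
    hence lt1: "p / u < 1" using ratio by linarith
    hence "p < u" using pos by simp
    from pm_space_eq_imp_grid_bound [OF \<Theta> pos p this eq] obtain A where A: "0 \<le> A"
      and bound: "\<And>m::nat. 1 \<le> m \<Longrightarrow>
        real m ^ CARD('n) * ?\<beta> \<le> A * ((real m ^ CARD('n) * ?\<beta> powr (1 - p0 / u0)) powr w0 *
          (measure lebesgue (ball (0 :: real ^ 'n) (real CARD('n) * (real m powr (p / u / (1 - p / u)) * real m) + 1))
            powr (1 - p1 / u1)) powr w1)"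
        "\<And>m::nat. 1 \<le> m \<Longrightarrow>
        real m ^ CARD('n) * ?\<beta> \<le> A * ((measure lebesgue (ball (0 :: real ^ 'n) (real CARD('n) *
            (real m powr (p / u / (1 - p / u)) * real m) + 1)) powr (1 - p0 / u0)) powr w0 *
          (real m ^ CARD('n) * ?\<beta> powr (1 - p1 / u1)) powr w1)"
      unfolding w0_def w1_def by blast
    \<comment> \<open>In either case \<open>mu\<close> is the larger ratio, whose space gets the
      large ball, and the small balls are used for the other space.\<close>
    from order show False
    proof
      assume "p0 / u0 < p / u \<and> p / u < p1 / u1"
      thus False
        using lt1 w w01 \<beta> A ratio bound(1)
        by (intro grid_growth_contradiction [where lam = "p / u" and mu = "p1 / u1" and wa = w0 and wb = w1
            and A = A and ba = "?\<beta> powr (1 - p0 / u0)" and \<beta> = ?\<beta> and 'n = 'n]) auto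
    next
      assume "p1 / u1 < p / u \<and> p / u < p0 / u0"
      thus False
        using lt1 w w01 \<beta> A ratio bound(2)
        by (intro grid_growth_contradiction [where lam = "p / u" and mu = "p0 / u0" and wa = w1 and wb = w0
            and A = A and ba = "?\<beta> powr (1 - p1 / u1)" and \<beta> = ?\<beta> and 'n = 'n]) (auto simp: mult_ac)
    qed
  qed
qed

end
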